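(* Let $n$ and $\delta$ be integers such that the set $\mathcal{T}_{n,\delta}$ of trees having $n$ vertices and diameter $\delta$ is nonempty. Then the unique (up to isomorphism) tree in $\mathcal{T}_{n,\delta}$ minimizing Kemeny's constant is the caterpillar $C_{\delta+1}((n-\delta-1)\mathbf{e}_t)$, with $t=\lceil\frac{\delta+1}{2}\rceil$ and $\mathbf{e}_t=(0,\dots,0,1,0,\dots,0)\in\mathbb{R}^{\delta+1}$ the $t$-th unit vector.
   Context: All graphs are finite, simple and undirected; isomorphic graphs are identified. For a connected graph $G$ on vertices $1,\dots,n$ with $n\ge 2$, adjacency matrix $A$ and diagonal degree matrix $D$, consider the random walk on $G$ with transition matrix $D^{-1}A$. Let $\mathbf{w}=(w_j)$ be its unique stationary distribution ($\mathbf{w}^TD^{-1}A=\mathbf{w}^T$, positive entries summing to $1$), and let $m_{ij}$ be the expected value of the smallest $s\geq 1$ such that the walk started at $i$ is at $j$ at time $s$ (so $m_{ii}$ is the mean return time). Kemeny's constant of $G$ is $\kappa(G)=\sum_{j=1}^n m_{ij}w_j-1$, which does not depend on $i$. By convention, Kemeny's constant of the one-vertex tree is $0$. For a positive integer $k$ and a nonnegative integer vector $\mathbf{p}=(p_1,\dots,p_k)$, the caterpillar $C_k(\mathbf{p})$ is the tree consisting of a path $c_1c_2\dots c_k$ on $k$ vertices together with $p_i$ pendent (degree-one) vertices attached to $c_i$ for each $i\le k$. *)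

theory Defs
  imports "HOL-Probability.Probability" "Graph_Theory.Graph_Theory"
begin

section \<open>Trees and their diameter\<close>

text \<open>
  A finite simple undirected graph is a \<open>pair_graph\<close>: every edge \<open>{u, v}\<close> is represented by the
  two arcs \<open>(u, v)\<close> and \<open>(v, u)\<close>. Because of this, a single edge traversed back and forth is already
  a \<open>cycle\<close> of the symmetric digraph, so the library's predicate \<open>tree\<close> does not describe
  undirected trees. The cycles of the undirected graph are the cycles of length at least 3.
\<close>

definition undirected_tree :: "'a pair_pre_digraph \<Rightarrow> bool" where
  "undirected_tree G \<longleftrightarrow> pair_graph G \<and> Digraph_Component.connected (with_proj G) \<and>
     \<not> (\<exists>p. pre_digraph.cycle (with_proj G) p \<and> length p \<ge> 3)"

text \<open>With unit weights, \<open>\<mu>\<close> is the usual distance, that is, the length of a shortest path.\<close>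

definition diameter :: "'a pair_pre_digraph \<Rightarrow> ereal" where
  "diameter G = (SUP u\<in>pverts G. SUP v\<in>pverts G. wf_digraph.\<mu> (with_proj G) (\<lambda>_. 1) u v)"

definition trees :: "nat \<Rightarrow> nat \<Rightarrow> 'a pair_pre_digraph set" where
  "trees n \<delta> = {T. undirected_tree T \<and> card (pverts T) = n \<and> diameter T = ereal (real \<delta>)}"

definition isomorphic :: "'a pair_pre_digraph \<Rightarrow> 'b pair_pre_digraph \<Rightarrow> bool" where
  "isomorphic G H \<longleftrightarrow> digraph_iso (with_proj G) (with_proj H)"


section \<open>The random walk on a graph\<close>

text \<open>
  One step of the walk moves to a uniformly chosen neighbour:
  \<open>pmf (walk_step G u) v = A\<^sub>u\<^sub>v / deg u\<close>, the entry of \<open>D\<^sup>-\<^sup>1 A\<close> at \<open>u\<close>, \<open>v\<close>, whenever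
  \<open>u\<close> has at least one and only finitely many neighbours.
\<close>

definition walk_step :: "'a pair_pre_digraph \<Rightarrow> 'a \<Rightarrow> 'a pmf" where
  "walk_step G u = pmf_of_set {v. (u, v) \<in> parcs G}"

text \<open>
  \<open>walk_kernel G i n \<omega>\<close> is the conditional law of the position at time \<open>n\<close>, given the positions
  \<open>\<omega> 0, \<dots>, \<omega> (n - 1)\<close> at the earlier times, of the walk started at \<open>i\<close>.
\<close>

definition walk_kernel :: "'a pair_pre_digraph \<Rightarrow> 'a \<Rightarrow> nat \<Rightarrow> (nat \<Rightarrow> 'a) \<Rightarrow> 'a measure" where
  "walk_kernel G i n \<omega> =
     measure_pmf (case n of 0 \<Rightarrow> return_pmf i | Suc m \<Rightarrow> walk_step G (\<omega> m))"

interpretation walk: Ionescu_Tulcea "walk_kernel G i" "\<lambda>_. count_space UNIV"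
  for G :: "'a pair_pre_digraph" and i :: 'a
proof (rule Ionescu_Tulcea.intro)
  show "walk_kernel G i n \<in> PiM {0..<n} (\<lambda>_. count_space UNIV) \<rightarrow>\<^sub>M subprob_algebra (count_space UNIV)"
    for n
  proof (cases n)
    case 0
    then show ?thesis
      by (simp add: walk_kernel_def[abs_def] measure_pmf_in_subprob_algebra)
  next
    case (Suc m)
    have "(\<lambda>\<omega>. \<omega> m) \<in> PiM {0..<n} (\<lambda>_. count_space UNIV :: 'a measure) \<rightarrow>\<^sub>M count_space UNIV"
      using Suc by (intro measurable_component_singleton) auto
    moreover have "(\<lambda>u. measure_pmf (walk_step G u)) \<in>
        count_space UNIV \<rightarrow>\<^sub>M subprob_algebra (count_space UNIV)"
      by (simp add: measure_pmf_in_subprob_algebra)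
    ultimately have "(\<lambda>\<omega>. measure_pmf (walk_step G (\<omega> m))) \<in>
        PiM {0..<n} (\<lambda>_. count_space UNIV) \<rightarrow>\<^sub>M subprob_algebra (count_space UNIV)"
      by (rule measurable_compose)
    then show ?thesis
      using Suc by (simp add: walk_kernel_def[abs_def])
  qed
  fix n and \<omega> :: "nat \<Rightarrow> 'a"
  show "prob_space (walk_kernel G i n \<omega>)"
    by (simp add: walk_kernel_def measure_pmf.prob_space_axioms)
qed

text \<open>The law, on the space of trajectories \<open>nat \<Rightarrow> 'a\<close>, of the walk started at \<open>i\<close>.\<close>

definition walk_law :: "'a pair_pre_digraph \<Rightarrow> 'a \<Rightarrow> (nat \<Rightarrow> 'a) measure" where
  "walk_law G i = walk.PF.lim G i"

text \<open>The smallest \<open>s \<ge> 1\<close> with \<open>\<omega> s = j\<close>; it is \<open>\<infinity>\<close> if there is none.\<close>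

definition first_passage_time :: "'a \<Rightarrow> (nat \<Rightarrow> 'a) \<Rightarrow> ennreal" where
  "first_passage_time j \<omega> = (INF s\<in>{s. s \<ge> 1 \<and> \<omega> s = j}. of_nat s)"

definition mean_first_passage_time :: "'a pair_pre_digraph \<Rightarrow> 'a \<Rightarrow> 'a \<Rightarrow> ennreal" where
  "mean_first_passage_time G i j = (\<integral>\<^sup>+\<omega>. first_passage_time j \<omega> \<partial>walk_law G i)"


section \<open>Kemeny's constant\<close>

text \<open>
  The condition \<open>set_pmf w = pverts G\<close> says that \<open>w\<close> lives on the vertices of \<open>G\<close> with all entries
  positive; the other one is \<open>w\<^sup>T D\<^sup>-\<^sup>1 A = w\<^sup>T\<close>.
\<close>

definition stationary_distribution :: "'a pair_pre_digraph \<Rightarrow> 'a pmf" where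
  "stationary_distribution G = (THE w. set_pmf w = pverts G \<and> bind_pmf w (walk_step G) = w)"

text \<open>
  On a connected graph with at least two vertices the value does not depend on the starting
  vertex \<open>i\<close>. The subtraction on \<^typ>\<open>ennreal\<close> is not truncated there: first passage times
  are at least 1, hence so is their weighted average.
\<close>

definition kemeny :: "'a pair_pre_digraph \<Rightarrow> ennreal" where
  "kemeny G = (if card (pverts G) = 1 then 0 else
     (THE \<kappa>. \<forall>i\<in>pverts G. \<kappa> =
        (\<Sum>j\<in>pverts G. mean_first_passage_time G i j *
           ennreal (pmf (stationary_distribution G) j)) - 1))"


section \<open>Caterpillars\<close>

text \<open>
  \<open>Spine i\<close> is the path vertex \<open>c\<^sub>i\<close>, and \<open>Pendent i j\<close> is the \<open>j\<close>-th pendent vertex attached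
  to it. Only the entries \<open>p 1, \<dots>, p k\<close> of the vector \<open>p\<close> are used.
\<close>

datatype caterpillar_vertex = Spine nat | Pendent nat nat

definition caterpillar :: "nat \<Rightarrow> (nat \<Rightarrow> nat) \<Rightarrow> caterpillar_vertex pair_pre_digraph" where
  "caterpillar k p =
     (let R = {(Spine i, Spine (i + 1)) |i. 1 \<le> i \<and> i < k} \<union>
              {(Spine i, Pendent i j) |i j. 1 \<le> i \<and> i \<le> k \<and> 1 \<le> j \<and> j \<le> p i}
      in \<lparr> pverts = {Spine i |i. 1 \<le> i \<and> i \<le> k} \<union>
                    {Pendent i j |i j. 1 \<le> i \<and> i \<le> k \<and> 1 \<le> j \<and> j \<le> p i},
           parcs = R \<union> R\<inverse> \<rparr>)"

definition unit_vector :: "nat \<Rightarrow> nat \<Rightarrow> nat" where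
  "unit_vector t i = (if i = t then 1 else 0)"

end

theory Submission
  imports Defs
begin

text \<open>
  For a tree on \<open>n \<ge> 2\<close> vertices, Kemeny's constant is an increasing function of the sum of all
  distances: it equals \<open>S / (n - 1) - n + 1 / 2\<close>, where \<open>S\<close> is the sum of \<open>d x y\<close> over all
  ordered pairs, that is, twice the Wiener index. So the trees to be found are those that minimize
  the Wiener index among the trees with given order and diameter.

  Everything is derived from the distance function. In a tree, the distances from any vertex \<open>x\<close>
  change by exactly one along every edge, and every other vertex has exactly one neighbour that is
  closer to \<open>x\<close>; conversely, a graph with a distance function of this kind is a tree. The locale
  \<open>tree_distance\<close> takes this as its axioms. They say that the Laplacian of
  \<open>d x\<close> at \<open>v\<close> is \<open>deg v - 2\<close>, or \<open>deg v\<close> if \<open>v = x\<close>. Hence the function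
  \<open>i \<mapsto> (\<Sum>v. deg v * (d i j + d j v - d i v)) / 2\<close> vanishes at \<open>j\<close> and satisfies the first-step
  equations for the expected time to reach \<open>j\<close>, so for \<open>i \<noteq> j\<close> it is that expectation
  (\<open>mean_first_passage_time_eqI\<close>). Averaging it with the stationary weights
  \<open>deg j / (2 * (n - 1))\<close> leaves the double sum of \<open>deg j * deg v * d j v\<close>, which double
  counting over the edges turns into an expression in \<open>S\<close> (\<open>kemeny_eq\<close>).

  For the lower bound on \<open>S\<close> let \<open>v\<^sub>0, \<dots>, v\<^sub>\<delta>\<close> be a longest geodesic. A vertex \<open>x\<close> off this path
  that hangs at height \<open>h \<ge> 1\<close> above its foot \<open>v\<^sub>p\<close> has distance \<open>h + \<bar>p - j\<bar>\<close> to \<open>v\<^sub>j\<close>, and the sum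
  over \<open>j\<close> is least when \<open>h = 1\<close> and \<open>p\<close> is central. Two distinct vertices off the path are at
  distance at least 2 unless they are adjacent; every such adjacency is paid for by a vertex of
  height at least 2 (\<open>dist_sum_lower_bound\<close>). In the case of equality all vertices off the path are
  leaves at one central vertex, which determines all distances, hence the tree up to isomorphism
  (\<open>centred_broom_of_min\<close>, \<open>centred_broom_imp_isomorphic\<close>).
\<close>

section \<open>Mean first passage times from the first-step equations\<close>

text \<open>
  The infinite trajectory space is needed only through its finite-dimensional marginals, which
  \<open>C 0 n\<close> builds by appending one step of the walk after the other.
\<close>

lemma nn_integral_walk_law:
  assumes "F \<in> borel_measurable (PiM {0..<n} (\<lambda>_. count_space UNIV))"
  shows "(\<integral>\<^sup>+\<omega>. F (restrict \<omega> {0..<n}) \<partial>walk_law G i) = (\<integral>\<^sup>+\<omega>. F \<omega> \<partial>walk.C G i 0 n (\<lambda>_. undefined))"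
proof -
  let ?P = "PiM {0..<n} (\<lambda>_. count_space UNIV :: 'a measure)"
  have up: "walk.up_to {0..<n} = n"
    using walk.up_to_iff_Ico[of "{0..<n}" n] walk.up_to[of "{0..<n}"]
    by (intro antisym) auto
  have sets: "sets (walk_law G i) = sets (PiM UNIV (\<lambda>_. count_space UNIV))"
    unfolding walk_law_def by (rule walk.PF.sets_lim)
  have "(\<lambda>\<omega>. restrict \<omega> {0..<n}) \<in> walk_law G i \<rightarrow>\<^sub>M ?P"
    by (subst measurable_cong_sets[OF sets refl]) (rule measurable_restrict_subset, simp)
  then have "(\<integral>\<^sup>+\<omega>. F (restrict \<omega> {0..<n}) \<partial>walk_law G i) =
      (\<integral>\<^sup>+\<omega>. F \<omega> \<partial>distr (walk_law G i) ?P (\<lambda>\<omega>. restrict \<omega> {0..<n}))"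
    using assms by (simp add: nn_integral_distr)
  also have "distr (walk_law G i) ?P (\<lambda>\<omega>. restrict \<omega> {0..<n}) = walk.CI G i {0..<n}"
    unfolding walk_law_def by (rule walk.distr_lim) simp
  also have "\<dots> = distr (walk.C G i 0 n (\<lambda>_. undefined)) ?P (\<lambda>\<omega>. restrict \<omega> {0..<n})"
    by (simp add: walk.CI_def up)
  also have "\<dots> = walk.C G i 0 n (\<lambda>_. undefined)"
    using walk.distr_C[of n n "\<lambda>_. undefined" 0 G i] by simp
  finally show ?thesis .
qed

text \<open>
  The function \<open>f\<close> of the position at time \<open>s\<close>, integrated over the event that the walk has not
  visited \<open>j\<close> at the times \<open>1, \<dots>, s\<close>. The start does not count as a visit, so the case \<open>i = j\<close>
  gives return times. For \<open>f = 1\<close> it is the tail probability of the first passage time.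
\<close>

definition survival :: "'a pair_pre_digraph \<Rightarrow> 'a \<Rightarrow> 'a \<Rightarrow> nat \<Rightarrow> ('a \<Rightarrow> ennreal) \<Rightarrow> ennreal" where
  "survival G i j s f =
     (\<integral>\<^sup>+\<omega>. (if \<forall>r\<in>{1..s}. \<omega> r \<noteq> j then f (\<omega> s) else 0) \<partial>walk_law G i)"

lemma survival_measurable:
  "(\<lambda>\<omega>. if \<forall>r\<in>{1..s}. \<omega> r \<noteq> j then f (\<omega> s) else (0::ennreal))
     \<in> borel_measurable (PiM {0..<Suc s} (\<lambda>_. count_space UNIV))"
proof -
  have [measurable]: "(\<lambda>\<omega>. \<omega> r) \<in> PiM {0..<Suc s} (\<lambda>_. count_space UNIV) \<rightarrow>\<^sub>M count_space UNIV"
    if "r \<le> s" for r using that by (intro measurable_component_singleton) auto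
  have [measurable]: "(\<lambda>\<omega>. f (\<omega> s)) \<in> borel_measurable (PiM {0..<Suc s} (\<lambda>_. count_space UNIV))"
    by (rule measurable_compose[of _ _ "count_space UNIV"]) auto
  have [measurable]: "Measurable.pred (PiM {0..<Suc s} (\<lambda>_. count_space UNIV)) (\<lambda>\<omega>. \<omega> r \<noteq> j)" 
    if "r \<in> {1..s}" for r
    by (rule measurable_compose[of _ _ "count_space UNIV"]) (use that in auto)
  show ?thesis by measurable
qed

lemma survival_C:
  "survival G i j s f =
     (\<integral>\<^sup>+\<omega>. (if \<forall>r\<in>{1..s}. \<omega> r \<noteq> j then f (\<omega> s) else 0) \<partial>walk.C G i 0 (Suc s) (\<lambda>_. undefined))"
  unfolding survival_def nn_integral_walk_law[OF survival_measurable, symmetric]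
  by (intro nn_integral_cong) auto

lemma survival_0: "survival G i j 0 f = f i"
proof -
  have undef: "(\<lambda>_. undefined) \<in> space (PiM {0..<0} (\<lambda>_. count_space UNIV))"
    by (simp add: space_PiM PiE_def extensional_def Pi_def)
  have "walk.C G i 0 (Suc 0) (\<lambda>_. undefined) = walk.eP G i 0 (\<lambda>_. undefined)"
    unfolding walk.C.simps add_0_right by (rule bind_return[OF walk.measurable_eP undef])
  then have "survival G i j 0 f = (\<integral>\<^sup>+x. f x \<partial>walk_kernel G i 0 (\<lambda>_. undefined))"
    unfolding survival_C
    using survival_measurable[of 0 j f] by (simp add: walk.nn_integral_eP[OF undef])
  then show ?thesis by (simp add: walk_kernel_def)
qed

text \<open>
  The Markov property at the last step: the law of the position at time \<open>s + 1\<close>, given the past,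
  is one step of the walk from the position at time \<open>s\<close>.
\<close>

lemma survival_Suc:
  "survival G i j (Suc s) f =
     survival G i j s (\<lambda>k. \<integral>\<^sup>+l. (if l \<noteq> j then f l else 0) \<partial>walk_step G k)"
proof -
  let ?F = "\<lambda>\<omega>. if \<forall>r\<in>{1..Suc s}. \<omega> r \<noteq> j then f (\<omega> (Suc s)) else 0"
  let ?C = "walk.C G i 0 (Suc s) (\<lambda>_. undefined)"
  have if_out: "(\<integral>\<^sup>+x. (if P then g x else 0) \<partial>M) = (if P then \<integral>\<^sup>+x. g x \<partial>M else 0)"
    for P and g :: "'a \<Rightarrow> ennreal" and M
    by (cases P) auto
  have "survival G i j (Suc s) f = (\<integral>\<^sup>+\<omega>. \<integral>\<^sup>+x. ?F x \<partial>walk.eP G i (Suc s) \<omega> \<partial>?C)"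
    unfolding survival_C walk.C.simps(2)[of G i 0 "Suc s"]
    by (subst nn_integral_bind[where B = "PiM {0..<Suc (Suc s)} (\<lambda>_. count_space UNIV)"])
       (use survival_measurable[of "Suc s" j f] in \<open>auto simp del: walk.C.simps simp add: measurable_cong_sets[OF walk.sets_C refl]\<close>)
  also have "\<dots> = (\<integral>\<^sup>+\<omega>. (if \<forall>r\<in>{1..s}. \<omega> r \<noteq> j
      then \<integral>\<^sup>+l. (if l \<noteq> j then f l else 0) \<partial>walk_step G (\<omega> s) else 0) \<partial>?C)"
  proof (intro nn_integral_cong)
    fix \<omega> assume "\<omega> \<in> space ?C"
    then have "\<omega> \<in> space (PiM {0..<Suc s} (\<lambda>_. count_space UNIV))"
      by (simp add: walk.space_C del: walk.C.simps)
    then have "(\<integral>\<^sup>+x. ?F x \<partial>walk.eP G i (Suc s) \<omega>) =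
        (\<integral>\<^sup>+l. ?F (fun_upd \<omega> (Suc s) l) \<partial>walk_step G (\<omega> s))"
      using survival_measurable[of "Suc s" j f]
      by (subst walk.nn_integral_eP) (auto simp: walk_kernel_def)
    also have "\<dots> = (\<integral>\<^sup>+l. (if \<forall>r\<in>{1..s}. \<omega> r \<noteq> j then (if l \<noteq> j then f l else 0) else 0) \<partial>walk_step G (\<omega> s))"
      by (intro nn_integral_cong) (auto simp: atLeastAtMostSuc_conv)
    also have "\<dots> = (if \<forall>r\<in>{1..s}. \<omega> r \<noteq> j
      then \<integral>\<^sup>+l. (if l \<noteq> j then f l else 0) \<partial>walk_step G (\<omega> s) else 0)"
      by (rule if_out)
    finally show "(\<integral>\<^sup>+x. ?F x \<partial>walk.eP G i (Suc s) \<omega>) = \<dots>" .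
  qed
  finally show ?thesis unfolding survival_C .
qed

text \<open>
  The \<open>s\<close>-th term is 1 as long as the first passage time exceeds \<open>s\<close>; the sum diverges if \<open>j\<close> is
  never visited.
\<close>

lemma first_passage_time_eq_suminf:
  "first_passage_time j \<omega> = (\<Sum>s. if \<forall>r\<in>{1..s}. \<omega> r \<noteq> j then 1 else 0)"
proof (cases "\<exists>s\<ge>1. \<omega> s = j")
  case True
  define m where "m = (LEAST s. s \<ge> 1 \<and> \<omega> s = j)"
  have m: "m \<ge> 1" "\<omega> m = j" using LeastI_ex[of "\<lambda>s. s \<ge> 1 \<and> \<omega> s = j"] True by (auto simp: m_def)
  have least: "m \<le> s" if "s \<ge> 1" "\<omega> s = j" for s
    unfolding m_def using that by (intro Least_le) auto
  have iff: "(\<forall>r\<in>{1..s}. \<omega> r \<noteq> j) \<longleftrightarrow> s < m" for s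
    using m least by (fastforce simp: not_less)
  have "(\<Sum>s. if \<forall>r\<in>{1..s}. \<omega> r \<noteq> j then 1 else 0) = (\<Sum>s<m. 1::ennreal)"
    unfolding iff by (subst suminf_finite[of "{..<m}"]) auto
  also have "\<dots> = of_nat m" by simp
  also have "\<dots> = first_passage_time j \<omega>"
    unfolding first_passage_time_def
    by (intro antisym INF_greatest INF_lower) (use m least in auto)
  finally show ?thesis by simp
next
  case False
  then have empty: "{s. s \<ge> 1 \<and> \<omega> s = j} = {}" by auto
  have all: "(\<forall>r\<in>{1..s}. \<omega> r \<noteq> j) = True" for s using False by auto
  then have "(\<Sum>s. if \<forall>r\<in>{1..s}. \<omega> r \<noteq> j then 1 else 0) = (\<Sum>s. 1::ennreal)" by (simp only: all if_True)
  also have "\<dots> = \<infinity>" 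
    by (simp add: nn_integral_count_space_nat[symmetric])
  finally show ?thesis unfolding first_passage_time_def empty by simp
qed

lemma mean_first_passage_time_eq_suminf:
  "mean_first_passage_time G i j = (\<Sum>s. survival G i j s (\<lambda>_. 1))"
proof -
  have "(\<lambda>\<omega>. if \<forall>r\<in>{1..s}. \<omega> r \<noteq> j then 1 else (0::ennreal)) \<in> borel_measurable (walk_law G i)" for s
  proof -
    have *: "(\<lambda>\<omega>. restrict \<omega> {0..<Suc s}) \<in> walk_law G i \<rightarrow>\<^sub>M PiM {0..<Suc s} (\<lambda>_. count_space UNIV)"
      unfolding walk_law_def
      by (subst measurable_cong_sets[OF walk.PF.sets_lim refl]) (rule measurable_restrict_subset, simp)
    show ?thesis
      using measurable_compose[OF * survival_measurable[of s j "\<lambda>_. 1"]]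
      by (rule measurable_cong[THEN iffD1, rotated]) auto
  qed
  then show ?thesis
    unfolding mean_first_passage_time_def first_passage_time_eq_suminf survival_def
    by (intro nn_integral_suminf)
qed


lemma survival_add:
  "survival G i j s (\<lambda>k. f k + g k) = survival G i j s f + survival G i j s g"
proof (induction s arbitrary: f g)
  case (Suc s)
  have "(\<integral>\<^sup>+l. (if l \<noteq> j then f l + g l else 0) \<partial>walk_step G k) =
      (\<integral>\<^sup>+l. (if l \<noteq> j then f l else 0) \<partial>walk_step G k) +
      (\<integral>\<^sup>+l. (if l \<noteq> j then g l else 0) \<partial>walk_step G k)" for k
    by (subst nn_integral_add[symmetric]) (auto intro!: nn_integral_cong)
  then show ?case unfolding survival_Suc Suc.IH[symmetric] by simp
qed (simp add: survival_0)

lemma survival_cmult: "survival G i j s (\<lambda>k. c * f k) = c * survival G i j s f"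
proof (induction s arbitrary: f)
  case (Suc s)
  have "(\<integral>\<^sup>+l. (if l \<noteq> j then c * f l else 0) \<partial>walk_step G k) =
      c * (\<integral>\<^sup>+l. (if l \<noteq> j then f l else 0) \<partial>walk_step G k)" for k
    by (subst nn_integral_cmult[symmetric]) (auto intro!: nn_integral_cong)
  then show ?case unfolding survival_Suc Suc.IH[symmetric] by simp
qed (simp add: survival_0)

lemma survival_mono:
  assumes "i \<in> V" and closed: "\<And>k. k \<in> V \<Longrightarrow> set_pmf (walk_step G k) \<subseteq> V"
    and "\<And>k. k \<in> V \<Longrightarrow> f k \<le> g k"
  shows "survival G i j s f \<le> survival G i j s g"
  using assms(3)
proof (induction s arbitrary: f g)
  case (Suc s)
  show ?case unfolding survival_Suc
    by (intro Suc.IH nn_integral_mono_AE AE_pmfI) (use closed Suc.prems in auto)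
qed (use assms(1) in \<open>simp add: survival_0\<close>)

text \<open>
  Any finite solution \<open>H\<close> of the first-step equations is the mean first passage time. Inserting
  the equation \<open>n\<close> times gives \<open>H i = (\<Sum>s<n. P(\<tau> > s)) + E[H(X\<^sub>n); \<tau> > n]\<close>, where \<open>\<tau>\<close> is the
  first passage time. The partial sums are therefore bounded by \<open>H i\<close>, so \<open>P(\<tau> > n)\<close> tends to 0, and
  the remainder tends to 0 with it because \<open>H\<close> is bounded on the finite set \<open>V\<close>.
\<close>

lemma mean_first_passage_time_eqI:
  assumes "finite V" and "i \<in> V" and closed: "\<And>k. k \<in> V \<Longrightarrow> set_pmf (walk_step G k) \<subseteq> V"
    and H: "\<And>k. k \<in> V \<Longrightarrow> H k = 1 + (\<integral>\<^sup>+l. (if l \<noteq> j then H l else 0) \<partial>walk_step G k)"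
    and fin: "\<And>k. k \<in> V \<Longrightarrow> H k < \<infinity>"
  shows "mean_first_passage_time G i j = H i"
proof -
  define a where "a s = survival G i j s (\<lambda>_. 1)" for s
  define r where "r s = survival G i j s H" for s
  define L where "L = (\<Sum>s. a s)"
  have step: "r s = a s + r (Suc s)" for s
  proof -
    have "r s = survival G i j s (\<lambda>k. 1 + (\<integral>\<^sup>+l. (if l \<noteq> j then H l else 0) \<partial>walk_step G k))"
      unfolding r_def by (intro antisym survival_mono[OF \<open>i \<in> V\<close> closed]) (simp_all add: H[symmetric])
    then show ?thesis by (simp add: survival_add survival_Suc r_def a_def)
  qed
  have telescope: "H i = (\<Sum>s<n. a s) + r n" for n
  proof (induction n)
    case 0
    show ?case by (simp add: r_def survival_0)
  next
    case (Suc n)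
    then show ?case by (simp add: step[of n] add.assoc)
  qed
  have sums: "(\<lambda>n. \<Sum>s<n. a s) \<longlonglongrightarrow> L"
    unfolding L_def by (rule summable_LIMSEQ) simp
  have partial: "(\<Sum>s<n. a s) \<le> H i" for n by (simp add: telescope[of n])
  have "L \<le> H i"
    by (rule LIMSEQ_le_const2[OF sums]) (simp add: partial)
  then have L: "L < \<infinity>" using fin[OF \<open>i \<in> V\<close>] by (rule le_less_trans)
  have "(\<lambda>n. (\<Sum>s<Suc n. a s) - (\<Sum>s<n. a s)) \<longlonglongrightarrow> L - L"
    using sums LIMSEQ_Suc[OF sums] L by (intro tendsto_diff_ennreal) auto
  moreover have "(\<Sum>s<Suc n. a s) - (\<Sum>s<n. a s) = a n" for n
  proof -
    from partial[of n] fin[OF \<open>i \<in> V\<close>] have "(\<Sum>s<n. a s) < \<infinity>" by (rule le_less_trans)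
    then have "(\<Sum>s<n. a s) \<noteq> top" by (metis infinity_ennreal_def less_irrefl)
    then show ?thesis unfolding sum.lessThan_Suc by (rule ennreal_add_diff_cancel_left)
  qed
  ultimately have "a \<longlonglongrightarrow> 0" using L by simp
  define B where "B = (\<Sum>k\<in>V. H k)"
  have B: "B < top" using fin \<open>finite V\<close> by (auto simp: B_def ennreal_sum_less_top)
  have r_le: "r n \<le> B * a n" for n
    unfolding r_def a_def survival_cmult[symmetric]
    by (rule survival_mono[OF \<open>i \<in> V\<close> closed])
       (auto simp: B_def intro!: member_le_sum \<open>finite V\<close>)
  have "(\<lambda>n. B * a n) \<longlonglongrightarrow> 0"
    using ennreal_tendsto_cmult[OF B \<open>a \<longlonglongrightarrow> 0\<close>] by simp
  then have "r \<longlonglongrightarrow> 0"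
    by (rule tendsto_sandwich[OF _ _ tendsto_const, rotated 2]) (simp_all add: r_le)
  from tendsto_add[OF sums this] have "(\<lambda>_. H i) \<longlonglongrightarrow> L"
    by (simp add: telescope[symmetric])
  then show ?thesis
    by (simp add: LIMSEQ_const_iff mean_first_passage_time_eq_suminf L_def a_def)
qed

section \<open>Distances in trees\<close>

text \<open>
  The neighbour given by \<open>parent\<close> is the predecessor of \<open>v\<close> on the path from \<open>x\<close>, that is, its
  parent in the tree rooted at \<open>x\<close>.
\<close>

locale tree_distance =
  fixes G :: "'a pair_pre_digraph" and d :: "'a \<Rightarrow> 'a \<Rightarrow> nat"
  assumes finite_verts: "finite (pverts G)" and verts_nonempty: "pverts G \<noteq> {}"
    and arcs_in_verts: "(u, v) \<in> parcs G \<Longrightarrow> u \<in> pverts G \<and> v \<in> pverts G"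
    and arc_sym: "(u, v) \<in> parcs G \<Longrightarrow> (v, u) \<in> parcs G"
    and dist_eq_0_iff: "u \<in> pverts G \<Longrightarrow> v \<in> pverts G \<Longrightarrow> d u v = 0 \<longleftrightarrow> u = v"
    and dist_sym: "u \<in> pverts G \<Longrightarrow> v \<in> pverts G \<Longrightarrow> d u v = d v u"
    and dist_step: "x \<in> pverts G \<Longrightarrow> (u, v) \<in> parcs G \<Longrightarrow>
      d x u = Suc (d x v) \<or> d x v = Suc (d x u)"
    and parent: "x \<in> pverts G \<Longrightarrow> v \<in> pverts G \<Longrightarrow> x \<noteq> v \<Longrightarrow>
      \<exists>!u. (u, v) \<in> parcs G \<and> d x v = Suc (d x u)"
begin

definition nbrs :: "'a \<Rightarrow> 'a set" where
  "nbrs v = {u. (v, u) \<in> parcs G}"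

definition deg :: "'a \<Rightarrow> real" where
  "deg v = real (card (nbrs v))"

definition num_verts :: real where
  "num_verts = real (card (pverts G))"

text \<open>
  Twice the Wiener index, as the sum runs over ordered pairs.
\<close>

definition dist_sum :: nat where
  "dist_sum = (\<Sum>x\<in>pverts G. \<Sum>y\<in>pverts G. d x y)"

lemma nbrs_subset: "nbrs v \<subseteq> pverts G"
  using arcs_in_verts by (auto simp: nbrs_def)

lemma nbrs_in_verts: "u \<in> nbrs v \<Longrightarrow> u \<in> pverts G"
  using nbrs_subset by blast

lemma finite_nbrs [simp]: "finite (nbrs v)"
  using nbrs_subset finite_verts by (rule finite_subset)

lemma nbrs_sym: "u \<in> nbrs v \<longleftrightarrow> v \<in> nbrs u"
  using arc_sym by (auto simp: nbrs_def)

lemma dist_self [simp]: "x \<in> pverts G \<Longrightarrow> d x x = 0"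
  by (simp add: dist_eq_0_iff)

lemma dist_eq_1_iff:
  assumes "u \<in> pverts G" "v \<in> pverts G"
  shows "d u v = 1 \<longleftrightarrow> (u, v) \<in> parcs G"
proof
  assume "d u v = 1"
  then have "u \<noteq> v" using assms by auto
  then obtain w where w: "(w, v) \<in> parcs G" "d u v = Suc (d u w)"
    using parent assms by blast
  then have "d u w = 0" "w \<in> pverts G" using \<open>d u v = 1\<close> arcs_in_verts by auto
  then show "(u, v) \<in> parcs G" using w assms by (simp add: dist_eq_0_iff)
next
  assume "(u, v) \<in> parcs G"
  from dist_step[OF assms(1) this] show "d u v = 1" using assms by auto
qed

lemma dist_induct [consumes 2, case_names self step]:
  assumes "x \<in> pverts G" "y \<in> pverts G" 
    and "P x" and "\<And>u v. (u, v) \<in> parcs G \<Longrightarrow> d x v = Suc (d x u) \<Longrightarrow> P u \<Longrightarrow> P v"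
  shows "P y"
  using assms(2)
proof (induction "d x y" arbitrary: y)
  case 0
  then show ?case using assms by (simp add: dist_eq_0_iff)
next
  case (Suc n)
  then have "x \<noteq> y" using assms by auto
  then obtain w where "(w, y) \<in> parcs G" "d x y = Suc (d x w)"
    using parent assms Suc by blast
  then show ?case using Suc arcs_in_verts assms(4) by auto
qed

lemma dist_triangle:
  assumes "x \<in> pverts G" "y \<in> pverts G" "z \<in> pverts G"
  shows "d x z \<le> d x y + d y z"
  using assms(2,3)
proof (induction rule: dist_induct)
  case self
  then show ?case by simp
next
  case (step u v)
  then show ?case using dist_step[OF assms(1) step(1)] by linarith
qed

end

lemma (in pair_wf_digraph) awalk_verts_eq_heads:
  assumes "awalk u p v"
  shows "awalk_verts u p = u # map snd p"
  using assms by (induction p arbitrary: u) (auto simp: awalk_simps)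

text \<open>
  Every edge of an acyclic graph is a bridge: shortcut a walk around the edge to a path, which has
  length at least 2, and close it with the edge to a cycle of length at least 3.
\<close>

lemma (in pair_graph) arc_in_awalk_of_acyclic:
  assumes acyclic: "\<nexists>p. cycle p \<and> length p \<ge> 3"
    and arc: "(u, v) \<in> parcs G" and p: "awalk u p v"
  shows "(u, v) \<in> set p"
proof (rule ccontr)
  assume not_in: "(u, v) \<notin> set p"
  define q where "q = awalk_to_apath p"
  have q: "apath u q v" "(u, v) \<notin> set q"
    using apath_awalk_to_apath[OF p] awalk_to_apath_subset[OF p] not_in by (auto simp: q_def)
  have uv: "u \<noteq> v" using no_loops'[OF arc] .
  have "length q \<ge> 2"
  proof (rule ccontr)
    assume "\<not> length q \<ge> 2"
    then consider "q = []" | a b where "q = [(a, b)]"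
      by (cases q; cases "tl q") auto
    then show False using q uv by cases (auto simp: apath_def awalk_simps)
  qed
  have walk: "awalk u q v" and dist: "distinct (awalk_verts u q)" using q by (auto simp: apath_def)
  have verts: "awalk_verts u q = u # tl (awalk_verts u q)"
    by (simp add: awalk_verts_eq_heads[OF walk])
  have arc': "awalk v [(v, u)] u"
    using arcs_symmetric[OF arc] arc by (auto simp: awalk_simps in_arcsD1)
  have "awalk u (q @ [(v, u)]) u" using walk arc' by (rule awalk_appendI)
  moreover have "tl (awalk_verts u (q @ [(v, u)])) = tl (awalk_verts u q) @ [u]"
    using verts by (simp add: awalk_verts_eq_heads[OF calculation] awalk_verts_eq_heads[OF walk])
  moreover have "distinct (tl (awalk_verts u q) @ [u])"
    using dist by (subst (asm) verts) simp
  ultimately have "cycle (q @ [(v, u)])" unfolding cycle_def by auto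
  then show False using acyclic \<open>length q \<ge> 2\<close> by fastforce
qed

definition walk_dist :: "'a pair_pre_digraph \<Rightarrow> 'a \<Rightarrow> 'a \<Rightarrow> nat" where
  "walk_dist G u v = (LEAST n. \<exists>p. pre_digraph.awalk (with_proj G) u p v \<and> length p = n)"

text \<open>
  A shortest walk from \<open>x\<close> to \<open>u\<close> runs through vertices that are closer to \<open>x\<close> than \<open>u\<close>. If the
  ends of an edge had the same distance from \<open>x\<close>, or if \<open>v\<close> had two neighbours closer to \<open>x\<close>, then
  two shortest walks would combine to a walk around an edge, contradicting that it is a bridge.
\<close>

lemma undirected_tree_imp_tree_distance:
  assumes "undirected_tree G"
  shows "tree_distance G (walk_dist G)"
proof -
  interpret pair_graph G using assms by (simp add: undirected_tree_def)
  have acyclic: "\<nexists>p. cycle p \<and> length p \<ge> 3"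
    using assms by (simp add: undirected_tree_def)
  have con: "Digraph_Component.connected (with_proj G)" using assms by (simp add: undirected_tree_def)
  let ?d = "walk_dist G"
  have le: "?d u v \<le> length p" if "awalk u p v" for u v p
    unfolding walk_dist_def using that by (intro Least_le) auto
  have ex: "\<exists>p. awalk u p v \<and> length p = ?d u v" if "u \<in> pverts G" "v \<in> pverts G" for u v
  proof -
    have "strongly_connected (with_proj G)"
      using symmetric_connected_imp_strongly_connected[OF pair_sym_arcs con] .
    then have "\<exists>p. awalk u p v" using that unfolding strongly_connected_def reachable_awalk by auto
    then show ?thesis unfolding walk_dist_def
      using LeastI_ex[of "\<lambda>n. \<exists>p. awalk u p v \<and> length p = n"] by blast
  qed
  have sym: "?d u v = ?d v u" if "u \<in> pverts G" "v \<in> pverts G" for u v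
  proof -
    have len: "length (rev_path p) = length p" for p :: "('a \<times> 'a) list" by (induction p) auto
    have "?d u v \<le> ?d v u" if uv: "u \<in> pverts G" "v \<in> pverts G" for u v
    proof -
      obtain p where p: "awalk v p u" "length p = ?d v u" using ex[OF uv(2,1)] by blast
      then show ?thesis using le[of u "rev_path p" v] len by simp
    qed
    then show ?thesis using that by (simp add: antisym)
  qed
  have arc_le: "?d x v \<le> Suc (?d x u)" if x: "x \<in> pverts G" and uv: "(u, v) \<in> parcs G" for x u v
  proof -
    obtain p where p: "awalk x p u" "length p = ?d x u" using ex[OF x in_arcsD1[OF uv]] by blast
    have "awalk u [(u, v)] v" using uv by (auto simp: awalk_simps in_arcsD2)
    with p have "awalk x (p @ [(u, v)]) v" using awalk_appendI by blast
    from le[OF this] show ?thesis using p by simp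
  qed
  have shortest: "\<exists>p. awalk x p u \<and> (\<forall>(a, b)\<in>set p. ?d x a < ?d x u \<and> ?d x b \<le> ?d x u)"
    if x: "x \<in> pverts G" and u: "u \<in> pverts G" for x u
  proof -
    obtain p where p: "awalk x p u" "length p = ?d x u" using ex[OF x u] by blast
    have "?d x a < ?d x u \<and> ?d x b \<le> ?d x u" if ab: "(a, b) \<in> set p" for a b
    proof -
      obtain q r where qr: "p = q @ (a, b) # r" using ab by (meson split_list)
      then have "awalk x q a" "(a, b) \<in> parcs G" using p(1) by (auto simp: awalk_simps)
      then show ?thesis using le[of x q a] arc_le[OF \<open>x \<in> pverts G\<close>, of a b] p(2) qr by simp
    qed
    with p show ?thesis by blast
  qed
  have rev_set: "set (rev_path p) = (\<lambda>(a, b). (b, a)) ` set p" for p :: "('a \<times> 'a) list"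
    by (induction p) (auto simp: case_prod_beta)
  show ?thesis
  proof
    show "finite (pverts G)" by simp
    show "pverts G \<noteq> {}" using con by (auto simp: Digraph_Component.connected_def strongly_connected_def)
    show "u \<in> pverts G \<and> v \<in> pverts G" if "(u, v) \<in> parcs G" for u v
      using that in_arcsD1 in_arcsD2 by auto
    show "(v, u) \<in> parcs G" if "(u, v) \<in> parcs G" for u v
      using that by (rule arcs_symmetric)
    show "?d u v = ?d v u" if "u \<in> pverts G" "v \<in> pverts G" for u v
      using that by (rule sym)
    show "?d u v = 0 \<longleftrightarrow> u = v" if "u \<in> pverts G" "v \<in> pverts G" for u v
    proof
      assume "?d u v = 0"
      with ex[OF that] show "u = v" by (auto simp: awalk_simps)
    next
      assume "u = v"
      then have "awalk u [] v" using that by (simp add: awalk_simps)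
      from le[OF this] show "?d u v = 0" by simp
    qed
    fix x assume x: "x \<in> pverts G"
    show "?d x u = Suc (?d x v) \<or> ?d x v = Suc (?d x u)" if uv: "(u, v) \<in> parcs G" for u v
    proof -
      have "?d x u \<noteq> ?d x v"
      proof
        assume eq: "?d x u = ?d x v"
        obtain p where p: "awalk x p u" "\<forall>(a, b)\<in>set p. ?d x a < ?d x u \<and> ?d x b \<le> ?d x u"
          using shortest[OF x in_arcsD1[OF uv]] by blast
        obtain q where q: "awalk x q v" "\<forall>(a, b)\<in>set q. ?d x a < ?d x v \<and> ?d x b \<le> ?d x v"
          using shortest[OF x in_arcsD2[OF uv]] by blast
        have "awalk u (rev_path p) x" using p(1) by simp
        then have "awalk u (rev_path p @ q) v" using q(1) by (rule awalk_appendI)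
        then have "(u, v) \<in> set (rev_path p @ q)"
          by (rule arc_in_awalk_of_acyclic[OF acyclic uv])
        then show False using p(2) q(2) eq by (auto simp: rev_set)
      qed
      then show ?thesis
        using arc_le[OF x uv] arc_le[OF x arcs_symmetric[OF uv]] by linarith
    qed
    show "\<exists>!u. (u, v) \<in> parcs G \<and> ?d x v = Suc (?d x u)" if v: "v \<in> pverts G" "x \<noteq> v" for v
    proof (rule ex_ex1I)
      obtain p where p: "awalk x p v" "length p = ?d x v" using ex x v by blast
      then have "p \<noteq> []" using v by (auto simp: awalk_simps)
      then obtain q a b where q: "p = q @ [(a, b)]" by (metis rev_exhaust surj_pair)
      then have w: "awalk x q a" "(a, b) \<in> parcs G" "b = v" using p by (auto simp: awalk_simps)
      then have "?d x v = Suc (?d x a)"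
        using le[OF w(1)] arc_le[OF x, of a v] p(2) q by simp
      then show "\<exists>u. (u, v) \<in> parcs G \<and> ?d x v = Suc (?d x u)" using w by auto
    next
      fix u1 u2
      assume u1: "(u1, v) \<in> parcs G \<and> ?d x v = Suc (?d x u1)"
        and u2: "(u2, v) \<in> parcs G \<and> ?d x v = Suc (?d x u2)"
      obtain p where p: "awalk x p u1" "\<forall>(a, b)\<in>set p. ?d x a < ?d x u1 \<and> ?d x b \<le> ?d x u1"
        using shortest[OF x, of u1] u1 in_arcsD1 by blast
      obtain q where q: "awalk x q u2" "\<forall>(a, b)\<in>set q. ?d x a < ?d x u2 \<and> ?d x b \<le> ?d x u2"
        using shortest[OF x, of u2] u2 in_arcsD1 by blast
      have "awalk u2 [(u2, v)] v" using u2 v by (auto simp: awalk_simps)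
      with q(1) have "awalk x (q @ [(u2, v)]) v" by (rule awalk_appendI)
      moreover have "awalk u1 (rev_path p) x" using p(1) by simp
      ultimately have "awalk u1 (rev_path p @ q @ [(u2, v)]) v" by (rule awalk_appendI[rotated])
      then have "(u1, v) \<in> set (rev_path p @ q @ [(u2, v)])"
        using u1 by (intro arc_in_awalk_of_acyclic[OF acyclic]) auto
      then show "u1 = u2" using p(2) q(2) u1 u2 by (auto simp: rev_set)
    qed
  qed
qed

context tree_distance begin

lemma pair_graph: "pair_graph G"
proof -
  have "parcs G \<subseteq> pverts G \<times> pverts G" using arcs_in_verts by auto
  then have fin: "finite (parcs G)"
    by (rule finite_subset) (simp add: finite_verts)
  have noloop: "(u, u) \<notin> parcs G" for u
    using dist_step[of u u u] arcs_in_verts[of u u] by auto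
  show ?thesis
    by unfold_locales
      (use arcs_in_verts finite_verts fin noloop in \<open>auto simp: symmetric_def arc_sym intro: symI\<close>)
qed

lemma awalk_dist_le:
  assumes "pre_digraph.awalk (with_proj G) u p v" "x \<in> pverts G"
  shows "d x v \<le> d x u + length p"
proof -
  interpret pair_graph G by (rule pair_graph)
  show ?thesis using assms(1)
  proof (induction p arbitrary: u)
    case Nil
    then show ?case by (simp add: awalk_simps)
  next
    case (Cons e p)
    obtain w where e: "e = (u, w)" using Cons.prems by (cases e) (auto simp: awalk_simps)
    have "d x v \<le> d x w + length p" using Cons e by (auto simp: awalk_simps)
    moreover have "d x w \<le> Suc (d x u)"
      using dist_step[OF assms(2), of u w] Cons.prems e by (auto simp: awalk_simps)
    ultimately show ?case by simp
  qed
qed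

lemma geodesic_awalk:
  assumes "x \<in> pverts G" "y \<in> pverts G"
  shows "\<exists>p. pre_digraph.awalk (with_proj G) x p y \<and> length p = d x y"
proof -
  interpret pair_graph G by (rule pair_graph)
  show ?thesis using assms
  proof (induction rule: dist_induct)
    case self
    then show ?case using assms by (intro exI[of _ "[]"]) (simp add: awalk_simps)
  next
    case (step u v)
    then obtain p where p: "awalk x p u" "length p = d x u" by auto
    have "awalk u [(u, v)] v" using step(1) arcs_in_verts by (auto simp: awalk_simps)
    with p have "awalk x (p @ [(u, v)]) v" using awalk_appendI by blast
    with p step show ?case by (intro exI[of _ "p @ [(u, v)]"]) auto
  qed
qed

lemma mu_eq_dist:
  assumes "x \<in> pverts G" "y \<in> pverts G"
  shows "wf_digraph.\<mu> (with_proj G) (\<lambda>_. 1) x y = ereal (real (d x y))"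
proof -
  interpret pair_graph G by (rule pair_graph)
  have cost: "awalk_cost (\<lambda>_. 1) p = real (length p)" for p :: "('a \<times> 'a) list"
    by (induction p) auto
  obtain q where q: "awalk x q y" "length q = d x y" using geodesic_awalk[OF assms] by blast
  show ?thesis unfolding \<mu>_def cost
  proof (intro antisym INF_greatest)
    show "(INF p\<in>{p. awalk x p y}. ereal (real (length p))) \<le> ereal (real (d x y))"
      using q by (intro INF_lower2[of q]) auto
    show "ereal (real (d x y)) \<le> ereal (real (length p))" if "p \<in> {p. awalk x p y}" for p
      using awalk_dist_le[of x p y x] that assms by simp
  qed
qed

text \<open>
  On a finite nonempty vertex set the suprema are attained.
\<close>

lemma diameter_eq_iff:
  "diameter G = ereal (real \<delta>) \<longleftrightarrow>
     (\<forall>x\<in>pverts G. \<forall>y\<in>pverts G. d x y \<le> \<delta>) \<and> (\<exists>x\<in>pverts G. \<exists>y\<in>pverts G. d x y = \<delta>)"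
proof -
  define D where "D = case_prod d ` (pverts G \<times> pverts G)"
  have D: "finite D" "D \<noteq> {}" using finite_verts verts_nonempty by (auto simp: D_def)
  obtain a b where ab: "a \<in> pverts G" "b \<in> pverts G" "d a b = Max D"
    using Max_in[OF D] by (auto simp: D_def)
  have le: "d x y \<le> Max D" if "x \<in> pverts G" "y \<in> pverts G" for x y
    using that D(1) by (intro Max_ge) (auto simp: D_def)
  have "diameter G = (SUP x\<in>pverts G. SUP y\<in>pverts G. ereal (real (d x y)))"
    unfolding diameter_def by (intro SUP_cong refl mu_eq_dist)
  also have "\<dots> = ereal (real (Max D))"
  proof (intro antisym SUP_least)
    show "ereal (real (d x y)) \<le> ereal (real (Max D))" if "x \<in> pverts G" "y \<in> pverts G" for x y
      using le[OF that] by simp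
    show "ereal (real (Max D)) \<le> (SUP x\<in>pverts G. SUP y\<in>pverts G. ereal (real (d x y)))"
      using ab by (intro SUP_upper2[of a] SUP_upper2[of b]) auto
  qed
  finally have "diameter G = ereal (real \<delta>) \<longleftrightarrow> Max D = \<delta>" by simp
  also have "\<dots> \<longleftrightarrow> (\<forall>x\<in>pverts G. \<forall>y\<in>pverts G. d x y \<le> \<delta>) \<and> (\<exists>x\<in>pverts G. \<exists>y\<in>pverts G. d x y = \<delta>)"
    using ab le by (metis antisym)
  finally show ?thesis .
qed

text \<open>
  On a cycle of length at least 3, a vertex at maximal distance from any \<open>x\<close> would have two
  different neighbours that are closer to \<open>x\<close>.
\<close>

lemma undirected_tree: "undirected_tree G"
proof -
  interpret pair_graph G by (rule pair_graph)
  have "\<exists>p. awalk x p y" if "x \<in> pverts G" "y \<in> pverts G" for x y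
    using geodesic_awalk that by blast
  then have "Digraph_Component.connected (with_proj G)"
    using verts_nonempty by (intro connectedI) (auto simp: reachable_awalk intro!: reachable_mk_symmetricI)
  moreover have False if p: "cycle p" "length p \<ge> 3" for p
  proof -
    define L where "L = length p"
    have L: "L \<ge> 3" using p(2) by (simp add: L_def)
    obtain u where u: "awalk u p u" "distinct (tl (awalk_verts u p))"
      using p(1) by (auto simp: cycle_def)
    \<comment> \<open>\<open>h\<close> runs around the cycle periodically, which avoids a case distinction at its base point.\<close>
    define h where "h i = snd (p ! (i mod L))" for i
    have dist: "distinct (map snd p)" using u by (simp add: awalk_verts_eq_heads)
    have h_eq: "i mod L = j mod L" if "h i = h j" for i j
    proof -
      have "i mod L < L" "j mod L < L" using L by simp_all
      then have "i mod L < length p" "j mod L < length p" unfolding L_def .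
      with that dist show ?thesis
        using nth_eq_iff_index_eq[OF dist, of "i mod L" "j mod L"] by (simp add: h_def)
    qed
    have period: "h (i + L) = h i" for i by (simp add: h_def)
    have consec: "fst (q ! Suc i) = snd (q ! i)" if "awalk w q z" "Suc i < length q" for q w z i
      using that
    proof (induction q arbitrary: w i)
      case (Cons e q)
      then show ?case by (cases i; cases q) (auto simp: awalk_simps)
    qed simp
    have arc: "(h i, h (Suc i)) \<in> parcs G" for i
    proof -
      have "Suc i mod L < length p" using L unfolding L_def[symmetric] by simp
      then have "p ! (Suc i mod L) \<in> parcs G" using u(1) nth_mem by (auto simp: awalk_def)
      moreover have "fst (p ! (Suc i mod L)) = h i"
      proof (cases "Suc (i mod L) = L")
        case True
        have "p \<noteq> []" using L by (auto simp: L_def)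
        have "fst (hd p) = u" using u(1) \<open>p \<noteq> []\<close> by (cases p) (auto simp: awalk_simps)
        moreover have "snd (last p) = u"
          using u(1) \<open>p \<noteq> []\<close> by (cases p rule: rev_cases) (auto simp: awalk_simps)
        moreover have "i mod L = L - 1" using True by simp
        ultimately show ?thesis
          using True \<open>p \<noteq> []\<close> by (simp add: mod_Suc h_def hd_conv_nth last_conv_nth L_def)
      next
        case False
        have "i mod L < L" using L by simp
        then show ?thesis using False consec[OF u(1), of "i mod L"] by (simp add: mod_Suc h_def L_def)
      qed
      ultimately show ?thesis by (cases "p ! (Suc i mod L)") (simp add: h_def)
    qed
    obtain x where x: "x \<in> pverts G" using verts_nonempty by auto
    have h_in: "h i \<in> pverts G" for i using arc[of i] arcs_in_verts by blast
    have "finite (range (\<lambda>i. d x (h i)))"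
      by (rule finite_subset[of _ "d x ` pverts G"]) (use h_in finite_verts in auto)
    then have "Max (range (\<lambda>i. d x (h i))) \<in> range (\<lambda>i. d x (h i))"
      and max: "d x (h i) \<le> Max (range (\<lambda>i. d x (h i)))" for i by auto
    then obtain j where j: "d x (h j) = Max (range (\<lambda>i. d x (h i)))" by (metis imageE)
    \<comment> \<open>One full turn further, so that the maximal vertex has a predecessor.\<close>
    define i where "i = j + L - 1"
    have "Suc i = j + L" using L by (simp add: i_def)
    then have top: "d x (h k) \<le> d x (h (Suc i))" for k using max[of k] j period by simp
    have s1: "d x (h (Suc i)) = Suc (d x (h i))"
      using dist_step[OF x arc[of i]] top[of i] by auto
    have s2: "d x (h (Suc i)) = Suc (d x (h (Suc (Suc i))))"
      using dist_step[OF x arc[of "Suc i"]] top[of "Suc (Suc i)"] by auto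
    have "x \<noteq> h (Suc i)" using s1 x by auto
    then have "h i = h (Suc (Suc i))"
      using parent[OF x h_in] arc[of i] arc_sym[OF arc[of "Suc i"]] s1 s2 by blast
    then have "i mod L = Suc (Suc i) mod L" by (rule h_eq)
    then have "L dvd Suc (Suc i) - i" by (intro mod_eq_dvd_iff_nat[THEN iffD1]) auto
    then have "L dvd 2" by simp
    then show False using L by (auto dest: dvd_imp_le)
  qed
  ultimately show ?thesis using pair_graph by (auto simp: undirected_tree_def)
qed

end

section \<open>Degrees and sums of distances\<close>

context tree_distance begin

text \<open>
  All neighbours of \<open>v\<close> except its parent are one step further away from \<open>x\<close>.
\<close>

lemma sum_nbrs_dist:
  fixes f :: "nat \<Rightarrow> real"
  assumes "x \<in> pverts G" "v \<in> pverts G"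
  shows "(\<Sum>u\<in>nbrs v. f (d x u)) =
    (if x = v then deg v * f 1 else f (d x v - 1) + (deg v - 1) * f (d x v + 1))"
proof (cases "x = v")
  case True
  have "(\<Sum>u\<in>nbrs v. f (d x u)) = (\<Sum>u\<in>nbrs v. f 1)"
  proof (intro sum.cong refl)
    fix u assume u: "u \<in> nbrs v"
    then have "d v u = 1" using dist_eq_1_iff[OF assms(2) nbrs_in_verts[OF u]] by (simp add: nbrs_def)
    then show "f (d x u) = f 1" using True by simp
  qed
  then show ?thesis using True by (simp add: deg_def)
next
  case False
  then obtain p where p: "(p, v) \<in> parcs G" "d x v = Suc (d x p)"
      and uniq: "\<And>u. (u, v) \<in> parcs G \<Longrightarrow> d x v = Suc (d x u) \<Longrightarrow> u = p"
    using parent[OF assms] by blast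
  have "p \<in> nbrs v" using p arc_sym by (auto simp: nbrs_def)
  then have "(\<Sum>u\<in>nbrs v. f (d x u)) = f (d x p) + (\<Sum>u\<in>nbrs v - {p}. f (d x u))"
    by (simp add: sum.remove)
  also have "(\<Sum>u\<in>nbrs v - {p}. f (d x u)) = (\<Sum>u\<in>nbrs v - {p}. f (d x v + 1))"
  proof (intro sum.cong refl)
    fix u assume "u \<in> nbrs v - {p}"
    then have "(u, v) \<in> parcs G" "u \<noteq> p" using arc_sym by (auto simp: nbrs_def)
    then show "f (d x u) = f (d x v + 1)"
      using dist_step[OF assms(1)] uniq by fastforce
  qed
  also have "\<dots> = (deg v - 1) * f (d x v + 1)"
  proof -
    have "card (nbrs v) \<ge> 1" using \<open>p \<in> nbrs v\<close> card_gt_0_iff[of "nbrs v"] by fastforce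
    then show ?thesis using \<open>p \<in> nbrs v\<close> by (simp add: deg_def card_Diff_singleton of_nat_diff)
  qed
  finally show ?thesis using False p(2) by simp
qed

lemma sum_nbrs_eq_sum_verts:
  fixes g :: "'a \<Rightarrow> real"
  shows "(\<Sum>u\<in>nbrs v. g u) = (\<Sum>u\<in>pverts G. if u \<in> nbrs v then g u else 0)"
  by (simp add: sum.inter_restrict[symmetric] finite_verts Int_absorb1 nbrs_subset)

lemma sum_sum_nbrs:
  fixes g :: "'a \<Rightarrow> real"
  shows "(\<Sum>v\<in>pverts G. \<Sum>u\<in>nbrs v. g u) = (\<Sum>u\<in>pverts G. deg u * g u)"
proof -
  have "(\<Sum>v\<in>pverts G. \<Sum>u\<in>nbrs v. g u) = (\<Sum>u\<in>pverts G. \<Sum>v\<in>pverts G. if v \<in> nbrs u then g u else 0)"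
    unfolding sum_nbrs_eq_sum_verts by (subst sum.swap) (simp add: nbrs_sym)
  also have "\<dots> = (\<Sum>u\<in>pverts G. deg u * g u)"
    unfolding sum_nbrs_eq_sum_verts[symmetric] by (simp add: deg_def)
  finally show ?thesis .
qed

lemma dist_laplacian:
  assumes "x \<in> pverts G" "v \<in> pverts G"
  shows "(\<Sum>u\<in>nbrs v. real (d x u)) = deg v * real (d x v) + deg v - (if x = v then 0 else 2)"
proof (cases "x = v")
  case False
  then have "d x v \<ge> 1" using assms dist_eq_0_iff[OF assms] by linarith
  then show ?thesis using False by (simp add: sum_nbrs_dist[OF assms] of_nat_diff algebra_simps)
qed (use assms in \<open>simp add: sum_nbrs_dist\<close>)

lemma dist_sq_laplacian:
  assumes "x \<in> pverts G" "v \<in> pverts G"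
  shows "(\<Sum>u\<in>nbrs v. (real (d x u))\<^sup>2) =
    deg v * (real (d x v))\<^sup>2 + deg v * (2 * real (d x v) + 1) - 4 * real (d x v)"
proof (cases "x = v")
  case False
  then have "d x v \<ge> 1" using assms dist_eq_0_iff[OF assms] by linarith
  then show ?thesis using False sum_nbrs_dist[OF assms, of "\<lambda>n. (real n)\<^sup>2"]
    by (simp add: of_nat_diff algebra_simps power2_eq_square)
qed (use assms in \<open>simp add: sum_nbrs_dist[of _ _ "\<lambda>n. (real n)\<^sup>2"]\<close>)

text \<open>
  The Laplacian of \<open>d x\<close> sums to 0 over all vertices. This counts the edges of the tree.
\<close>

lemma sum_deg: "(\<Sum>v\<in>pverts G. deg v) = 2 * (num_verts - 1)"
proof -
  obtain x where x: "x \<in> pverts G" using verts_nonempty by auto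
  have "(\<Sum>v\<in>pverts G. deg v * real (d x v)) =
      (\<Sum>v\<in>pverts G. deg v * real (d x v) + deg v - (if x = v then 0 else 2))"
    unfolding sum_sum_nbrs[symmetric] by (intro sum.cong refl dist_laplacian x)
  also have "\<dots> = (\<Sum>v\<in>pverts G. deg v * real (d x v)) + (\<Sum>v\<in>pverts G. deg v)
      - (\<Sum>v\<in>pverts G. if x = v then 0 else 2)"
    by (simp add: sum.distrib sum_subtractf)
  also have "(\<Sum>v\<in>pverts G. if x = v then 0 else (2::real)) = 2 * (num_verts - 1)"
  proof -
    have "(\<Sum>v\<in>pverts G. if x = v then 0 else (2::real)) = (\<Sum>v\<in>pverts G. 2 - (if x = v then 2 else 0))"
      by (intro sum.cong) auto
    then show ?thesis using x by (simp add: sum_subtractf finite_verts num_verts_def)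
  qed
  finally show ?thesis by simp
qed

text \<open>
  The same for the square of \<open>d x\<close>, whose Laplacian contains \<open>deg v * d x v\<close>.
\<close>

lemma sum_deg_dist:
  assumes x: "x \<in> pverts G"
  shows "(\<Sum>v\<in>pverts G. deg v * real (d x v)) = 2 * (\<Sum>v\<in>pverts G. real (d x v)) - (num_verts - 1)"
proof -
  have "(\<Sum>v\<in>pverts G. deg v * (real (d x v))\<^sup>2) = (\<Sum>v\<in>pverts G.
      deg v * (real (d x v))\<^sup>2 + (2 * (deg v * real (d x v)) + deg v) - 4 * real (d x v))"
    unfolding sum_sum_nbrs[symmetric]
    by (intro sum.cong refl) (simp add: dist_sq_laplacian[OF x] algebra_simps)
  also have "\<dots> = (\<Sum>v\<in>pverts G. deg v * (real (d x v))\<^sup>2)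
      + (2 * (\<Sum>v\<in>pverts G. deg v * real (d x v)) + 2 * (num_verts - 1))
      - 4 * (\<Sum>v\<in>pverts G. real (d x v))"
    by (simp add: sum.distrib sum_subtractf sum_distrib_left sum_deg)
  finally show ?thesis by simp
qed

lemma sum_deg_deg_dist:
  "(\<Sum>x\<in>pverts G. \<Sum>v\<in>pverts G. deg x * deg v * real (d x v)) =
     4 * real dist_sum - 2 * (num_verts - 1) * (2 * num_verts - 1)"
proof -
  have "(\<Sum>x\<in>pverts G. \<Sum>v\<in>pverts G. deg x * deg v * real (d x v)) =
      (\<Sum>x\<in>pverts G. deg x * (\<Sum>v\<in>pverts G. deg v * real (d x v)))"
    by (simp add: sum_distrib_left mult.assoc)
  also have "\<dots> = (\<Sum>x\<in>pverts G. 2 * (\<Sum>v\<in>pverts G. deg x * real (d v x)) - (num_verts - 1) * deg x)"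
    by (intro sum.cong refl) (simp add: sum_deg_dist sum_distrib_left algebra_simps dist_sym)
  also have "\<dots> = 2 * (\<Sum>v\<in>pverts G. \<Sum>x\<in>pverts G. deg x * real (d v x))
      - (num_verts - 1) * (2 * (num_verts - 1))"
    by (subst sum.swap) (simp add: sum_subtractf sum_distrib_left[symmetric] sum_deg)
  also have "(\<Sum>v\<in>pverts G. \<Sum>x\<in>pverts G. deg x * real (d v x)) =
      2 * real dist_sum - num_verts * (num_verts - 1)"
    by (simp add: sum_deg_dist sum_subtractf sum_distrib_left[symmetric] dist_sum_def num_verts_def
        cong: sum.cong)
  finally show ?thesis by (simp add: algebra_simps)
qed

end

section \<open>Kemeny's constant of a tree\<close>

context tree_distance begin

text \<open>
  In an electrical network with unit resistances, the expected time to reach \<open>j\<close> from \<open>i\<close> is given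
  by this formula with effective resistances in place of distances; in a tree these coincide.
\<close>

definition hitting_time :: "'a \<Rightarrow> 'a \<Rightarrow> real" where
  "hitting_time j i = (\<Sum>v\<in>pverts G. deg v * (real (d i j) + real (d j v) - real (d i v))) / 2"

lemma hitting_time_self [simp]: "j \<in> pverts G \<Longrightarrow> hitting_time j j = 0"
  by (simp add: hitting_time_def)

lemma hitting_time_nonneg:
  assumes "i \<in> pverts G" "j \<in> pverts G"
  shows "hitting_time j i \<ge> 0"
proof -
  have "real (d i v) \<le> real (d i j) + real (d j v)" if "v \<in> pverts G" for v
    using dist_triangle[OF assms that] by linarith
  then show ?thesis unfolding hitting_time_def
    by (intro divide_nonneg_pos sum_nonneg mult_nonneg_nonneg) (auto simp: deg_def)
qed

text \<open>
  The Laplacians of \<open>d j\<close> and of \<open>d v\<close> at \<open>i\<close> cancel up to the terms with \<open>v = i\<close>, if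
  \<open>i \<noteq> j\<close>, and up to the terms with \<open>v \<noteq> i\<close>, if \<open>i = j\<close>. In the second case the result describes
  the mean return time.
\<close>

lemma sum_nbrs_hitting_time:
  assumes "i \<in> pverts G" "j \<in> pverts G"
  shows "(\<Sum>u\<in>nbrs i. hitting_time j u) =
    (if i = j then 2 * (num_verts - 1) - deg j else deg i * hitting_time j i - deg i)"
proof -
  have lap: "(\<Sum>u\<in>nbrs i. real (d u v)) = deg i * real (d i v) + deg i - (if i = v then 0 else 2)"
    if "v \<in> pverts G" for v
  proof -
    have "(\<Sum>u\<in>nbrs i. real (d u v)) = (\<Sum>u\<in>nbrs i. real (d v u))"
      by (intro sum.cong refl arg_cong[of _ _ real] dist_sym[OF _ that]) (rule nbrs_in_verts)
    then show ?thesis using dist_laplacian[OF that assms(1)] that assms by (auto simp: dist_sym)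
  qed
  have "2 * (\<Sum>u\<in>nbrs i. hitting_time j u) =
      (\<Sum>v\<in>pverts G. \<Sum>u\<in>nbrs i. deg v * (real (d u j) + real (d j v) - real (d u v)))"
    unfolding sum_distrib_left by (subst sum.swap) (simp add: hitting_time_def)
  also have "\<dots> = (\<Sum>v\<in>pverts G. deg i * (deg v * (real (d i j) + real (d j v) - real (d i v)))
      + (if i = j then 2 * deg v - (if i = v then 2 * deg v else 0) else - (if i = v then 2 * deg v else 0)))"
  proof (intro sum.cong refl)
    fix v assume v: "v \<in> pverts G"
    have "(\<Sum>u\<in>nbrs i. deg v * (real (d u j) + real (d j v) - real (d u v))) =
      deg v * ((\<Sum>u\<in>nbrs i. real (d u j)) + deg i * real (d j v) - (\<Sum>u\<in>nbrs i. real (d u v)))"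
      by (simp add: sum_distrib_left[symmetric] sum.distrib sum_subtractf deg_def)
    then show "(\<Sum>u\<in>nbrs i. deg v * (real (d u j) + real (d j v) - real (d u v))) =
      deg i * (deg v * (real (d i j) + real (d j v) - real (d i v)))
      + (if i = j then 2 * deg v - (if i = v then 2 * deg v else 0) else - (if i = v then 2 * deg v else 0))"
      unfolding lap[OF v] lap[OF assms(2)] by (auto simp: algebra_simps)
  qed
  also have "\<dots> = 2 * (deg i * hitting_time j i) +
      (if i = j then 4 * (num_verts - 1) - 2 * deg j else - 2 * deg i)"
    using assms
    by (simp add: sum.distrib sum_subtractf sum_distrib_left[symmetric] hitting_time_def sum_deg
        finite_verts sum_negf)
  finally show ?thesis using assms by (auto simp: field_simps)
qed

lemma deg_pos:
  assumes "card (pverts G) \<ge> 2" "v \<in> pverts G"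
  shows "deg v > 0"
proof -
  have "pverts G \<noteq> {v}" using assms(1) by auto
  then obtain x where "x \<in> pverts G" "x \<noteq> v" using assms(2) by auto
  then obtain u where "(u, v) \<in> parcs G" using parent assms(2) by blast
  then have "u \<in> nbrs v" using arc_sym by (auto simp: nbrs_def)
  then show ?thesis by (auto simp: deg_def card_gt_0_iff)
qed

lemma mean_first_passage_time_tree:
  assumes n: "card (pverts G) \<ge> 2" and i: "i \<in> pverts G" and j: "j \<in> pverts G"
  shows "mean_first_passage_time G i j =
    ennreal (hitting_time j i + (if i = j then 2 * (num_verts - 1) / deg j else 0))"
proof -
  define H where "H k = ennreal (hitting_time j k + (if k = j then 2 * (num_verts - 1) / deg j else 0))" for k
  have nbrs: "{v. (k, v) \<in> parcs G} = nbrs k" "nbrs k \<noteq> {}" if "k \<in> pverts G" for k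
    using deg_pos[OF n that] by (auto simp: deg_def card_gt_0_iff nbrs_def)
  have "mean_first_passage_time G i j = H i"
  proof (rule mean_first_passage_time_eqI[OF finite_verts i])
    fix k assume k: "k \<in> pverts G"
    show "set_pmf (walk_step G k) \<subseteq> pverts G"
      using nbrs[OF k] nbrs_subset by (simp add: walk_step_def)
    show "H k < \<infinity>" by (simp add: H_def)
    have "(\<integral>\<^sup>+l. (if l \<noteq> j then H l else 0) \<partial>walk_step G k) =
        (\<Sum>l\<in>nbrs k. if l \<noteq> j then H l else 0) / ennreal (deg k)"
      using nbrs[OF k] by (simp add: walk_step_def nn_integral_pmf_of_set deg_def ennreal_of_nat_eq_real_of_nat)
    also have "(\<Sum>l\<in>nbrs k. if l \<noteq> j then H l else 0) = (\<Sum>l\<in>nbrs k. ennreal (hitting_time j l))"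
      using j by (intro sum.cong) (auto simp: H_def)
    also have "\<dots> = ennreal (\<Sum>l\<in>nbrs k. hitting_time j l)"
      using nbrs_subset j by (intro sum_ennreal hitting_time_nonneg) auto
    also have "\<dots> / ennreal (deg k) = ennreal ((\<Sum>l\<in>nbrs k. hitting_time j l) / deg k)"
      using nbrs_subset j by (intro divide_ennreal sum_nonneg hitting_time_nonneg deg_pos n k) auto
    finally have "1 + (\<integral>\<^sup>+l. (if l \<noteq> j then H l else 0) \<partial>walk_step G k) =
        ennreal (1 + (\<Sum>l\<in>nbrs k. hitting_time j l) / deg k)"
      using nbrs_subset j deg_pos[OF n k]
      by (subst ennreal_plus) (auto intro!: divide_nonneg_pos sum_nonneg hitting_time_nonneg)
    also have "1 + (\<Sum>l\<in>nbrs k. hitting_time j l) / deg k =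
        hitting_time j k + (if k = j then 2 * (num_verts - 1) / deg j else 0)"
      unfolding sum_nbrs_hitting_time[OF k j] using deg_pos[OF n k] j by (auto simp: field_simps)
    finally show "H k = 1 + (\<integral>\<^sup>+l. (if l \<noteq> j then H l else 0) \<partial>walk_step G k)"
      by (simp add: H_def)
  qed
  then show ?thesis by (simp add: H_def)
qed

text \<open>
  The Dirichlet energy of a harmonic function, the sum of \<open>(f v - f u)\<^sup>2\<close> over all edges, is 0.
\<close>

lemma harmonic_imp_constant:
  fixes f :: "'a \<Rightarrow> real"
  assumes harmonic: "\<And>v. v \<in> pverts G \<Longrightarrow> (\<Sum>u\<in>nbrs v. f u) = deg v * f v"
    and "x \<in> pverts G" "y \<in> pverts G"
  shows "f y = f x"
proof -
  have "(\<Sum>v\<in>pverts G. \<Sum>u\<in>nbrs v. (f v - f u)\<^sup>2) =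
      (\<Sum>v\<in>pverts G. (\<Sum>u\<in>nbrs v. (f u)\<^sup>2) - deg v * (f v)\<^sup>2)"
  proof (intro sum.cong refl)
    fix v assume v: "v \<in> pverts G"
    have "(\<Sum>u\<in>nbrs v. (f v - f u)\<^sup>2) = (\<Sum>u\<in>nbrs v. (f v)\<^sup>2 + (f u)\<^sup>2 - 2 * f v * f u)"
      by (simp add: power2_diff)
    also have "\<dots> = deg v * (f v)\<^sup>2 + (\<Sum>u\<in>nbrs v. (f u)\<^sup>2) - 2 * f v * (\<Sum>u\<in>nbrs v. f u)"
      by (simp add: sum.distrib sum_subtractf sum_distrib_left deg_def)
    finally show "(\<Sum>u\<in>nbrs v. (f v - f u)\<^sup>2) = (\<Sum>u\<in>nbrs v. (f u)\<^sup>2) - deg v * (f v)\<^sup>2"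
      by (simp add: harmonic[OF v] power2_eq_square)
  qed
  also have "\<dots> = 0"
    by (simp add: sum_subtractf sum_sum_nbrs)
  finally have local_zero: "(\<Sum>u\<in>nbrs v. (f v - f u)\<^sup>2) = 0" if "v \<in> pverts G" for v
    using that finite_verts by (subst (asm) sum_nonneg_eq_0_iff) (auto intro: sum_nonneg)
  then have arc: "f u = f v" if "(u, v) \<in> parcs G" for u v
  proof -
    have "v \<in> pverts G" "u \<in> nbrs v" using that arcs_in_verts arc_sym by (auto simp: nbrs_def)
    then have "(f v - f u)\<^sup>2 = 0"
      using local_zero[of v] by (subst (asm) sum_nonneg_eq_0_iff) auto
    then show ?thesis by simp
  qed
  show ?thesis
    using assms(2,3) by (induction rule: dist_induct) (auto dest: arc)
qed

lemma pmf_bind_walk_step: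
  assumes n: "card (pverts G) \<ge> 2" and w: "set_pmf w = pverts G" and j: "j \<in> pverts G"
  shows "pmf (bind_pmf w (walk_step G)) j = (\<Sum>k\<in>nbrs j. pmf w k / deg k)"
proof -
  have "pmf (bind_pmf w (walk_step G)) j = (\<Sum>k\<in>pverts G. pmf w k * pmf (walk_step G k) j)"
    unfolding pmf_bind using finite_verts w
    by (subst integral_measure_pmf[of "pverts G"]) auto
  also have "\<dots> = (\<Sum>k\<in>pverts G. if k \<in> nbrs j then pmf w k / deg k else 0)"
  proof (intro sum.cong refl)
    fix k assume k: "k \<in> pverts G"
    have "{v. (k, v) \<in> parcs G} = nbrs k" "nbrs k \<noteq> {}"
      using deg_pos[OF n k] by (auto simp: deg_def card_gt_0_iff nbrs_def)
    then show "pmf w k * pmf (walk_step G k) j = (if k \<in> nbrs j then pmf w k / deg k else 0)"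
      by (auto simp: walk_step_def deg_def nbrs_sym[of j k])
  qed
  finally show ?thesis by (simp add: sum_nbrs_eq_sum_verts)
qed

text \<open>
  Stationarity of \<open>w\<close> means that \<open>w k / deg k\<close> is harmonic, hence constant. The stationary
  distribution exists, as the law of the tail of a uniformly chosen arc.
\<close>

lemma pmf_stationary_distribution:
  assumes n: "card (pverts G) \<ge> 2" and j: "j \<in> pverts G"
  shows "pmf (stationary_distribution G) j = deg j / (2 * (num_verts - 1))"
proof -
  let ?Q = "\<lambda>w. set_pmf w = pverts G \<and> bind_pmf w (walk_step G) = w"
  have pos: "num_verts - 1 > 0" using n by (simp add: num_verts_def)
  have char: "pmf w v = deg v / (2 * (num_verts - 1))" if "?Q w" "v \<in> pverts G" for w v
  proof -
    define f where "f k = pmf w k / deg k" for k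
    have "(\<Sum>u\<in>nbrs k. f u) = deg k * f k" if "k \<in> pverts G" for k
      using pmf_bind_walk_step[OF n _ that, of w] \<open>?Q w\<close> deg_pos[OF n that] by (simp add: f_def)
    then have const: "f k = f v" if "k \<in> pverts G" for k
      using harmonic_imp_constant that \<open>v \<in> pverts G\<close> by blast
    have "1 = (\<Sum>k\<in>pverts G. pmf w k)"
      using sum_pmf_eq_1[of "pverts G" w] finite_verts \<open>?Q w\<close> by simp
    also have "\<dots> = (\<Sum>k\<in>pverts G. deg k * f v)"
    proof (intro sum.cong refl)
      fix k assume k: "k \<in> pverts G"
      show "pmf w k = deg k * f v"
        using deg_pos[OF n k] const[OF k] by (simp add: f_def field_simps)
    qed
    also have "\<dots> = 2 * (num_verts - 1) * f v"
      by (simp add: sum_distrib_right[symmetric] sum_deg)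
    finally show ?thesis
      using pos deg_pos[OF n \<open>v \<in> pverts G\<close>] by (simp add: f_def field_simps)
  qed
  have "parcs G \<subseteq> pverts G \<times> pverts G" using arcs_in_verts by auto
  then have finA: "finite (parcs G)" using finite_verts by (rule finite_subset[OF _ finite_cartesian_product]) (rule finite_verts)
  obtain u where "u \<in> nbrs j" using deg_pos[OF n j] by (auto simp: deg_def card_gt_0_iff)
  then have neA: "parcs G \<noteq> {}" by (auto simp: nbrs_def)
  define w where "w = map_pmf fst (pmf_of_set (parcs G))"
  have set_w: "set_pmf w = pverts G"
  proof -
    have "v \<in> fst ` parcs G" if v: "v \<in> pverts G" for v
    proof -
      obtain u where "u \<in> nbrs v" using deg_pos[OF n v] by (auto simp: deg_def card_gt_0_iff)
      then show ?thesis by (force simp: nbrs_def)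
    qed
    then show ?thesis using finA neA arcs_in_verts by (auto simp: w_def)
  qed
  have w: "pmf w v = deg v / real (card (parcs G))" for v
  proof -
    have "parcs G \<inter> fst -` {v} = Pair v ` nbrs v" by (auto simp: nbrs_def)
    then show ?thesis
      using finA neA by (simp add: w_def pmf_map measure_pmf_of_set card_image inj_on_def deg_def)
  qed
  have "bind_pmf w (walk_step G) = w"
  proof (rule pmf_eqI)
    fix v
    show "pmf (bind_pmf w (walk_step G)) v = pmf w v"
    proof (cases "v \<in> pverts G")
      case True
      have "(\<Sum>k\<in>nbrs v. pmf w k / deg k) = (\<Sum>k\<in>nbrs v. 1 / real (card (parcs G)))"
      proof (intro sum.cong refl)
        fix k assume "k \<in> nbrs v"
        then have "deg k > 0" using deg_pos[OF n] nbrs_in_verts by blast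
        then show "pmf w k / deg k = 1 / real (card (parcs G))" by (simp add: w)
      qed
      then show ?thesis using pmf_bind_walk_step[OF n set_w True] by (simp add: w deg_def)
    next
      case False
      have "set_pmf (walk_step G k) \<subseteq> pverts G" if "k \<in> pverts G" for k
      proof -
        have "{v. (k, v) \<in> parcs G} = nbrs k" "nbrs k \<noteq> {}"
          using deg_pos[OF n that] by (auto simp: deg_def card_gt_0_iff nbrs_def)
        then show ?thesis using nbrs_subset by (simp add: walk_step_def)
      qed
      then have "v \<notin> set_pmf (bind_pmf w (walk_step G))" using False set_w by auto
      moreover have "v \<notin> set_pmf w" using False set_w by simp
      ultimately show ?thesis by (metis pmf_eq_0_set_pmf)
    qed
  qed
  with set_w have "?Q w" by simp
  moreover have "w' = w" if "?Q w'" for w'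
  proof (rule pmf_eqI)
    fix v show "pmf w' v = pmf w v"
    proof (cases "v \<in> pverts G")
      case True
      then show ?thesis using char[OF that True] char[OF \<open>?Q w\<close> True] by simp
    next
      case False
      then have "v \<notin> set_pmf w'" "v \<notin> set_pmf w" using that set_w by auto
      then show ?thesis by (simp add: set_pmf_iff)
    qed
  qed
  ultimately have "?Q (stationary_distribution G)"
    unfolding stationary_distribution_def by (rule theI)
  then show ?thesis using j by (rule char)
qed

text \<open>
  In the average of the hitting times over \<open>j\<close> with weights \<open>deg j\<close>, the terms with \<open>d i j\<close> and
  \<open>d i v\<close> cancel by symmetry, so that the starting vertex disappears. The return time contributes
  exactly the 1 that is subtracted in the definition of Kemeny's constant.
\<close>

theorem kemeny_eq:
  assumes n: "card (pverts G) \<ge> 2"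
  shows "kemeny G = ennreal (real dist_sum / (num_verts - 1) - num_verts + 1 / 2)" (is "_ = ennreal ?K")
    and "real dist_sum / (num_verts - 1) - num_verts + 1 / 2 \<ge> 0"
proof -
  let ?m = "2 * (num_verts - 1)"
  have pos: "num_verts - 1 > 0" using n by (simp add: num_verts_def)
  have sum_hit: "(\<Sum>j\<in>pverts G. hitting_time j i * (deg j / ?m)) = ?K" if i: "i \<in> pverts G" for i
  proof -
    have "(\<Sum>j\<in>pverts G. hitting_time j i * deg j) =
        (\<Sum>j\<in>pverts G. \<Sum>v\<in>pverts G. deg j * deg v * real (d i j) + deg j * deg v * real (d j v)
          - deg v * deg j * real (d i v)) / 2"
      by (simp add: hitting_time_def sum_distrib_left sum_divide_distrib algebra_simps)
    also have "\<dots> = (\<Sum>j\<in>pverts G. \<Sum>v\<in>pverts G. deg j * deg v * real (d j v)) / 2"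
      unfolding sum.distrib sum_subtractf
      by (subst (3) sum.swap) (simp add: mult.commute)
    finally have "(\<Sum>j\<in>pverts G. hitting_time j i * deg j) =
        (4 * real dist_sum - 2 * (num_verts - 1) * (2 * num_verts - 1)) / 2"
      unfolding sum_deg_deg_dist .
    then have "(\<Sum>j\<in>pverts G. hitting_time j i * (deg j / ?m)) =
      (4 * real dist_sum - 2 * (num_verts - 1) * (2 * num_verts - 1)) / 2 / ?m"
      by (simp only: times_divide_eq_right sum_divide_distrib[symmetric])
    also have "\<dots> = ?K" using pos by (simp add: field_simps)
    finally show ?thesis .
  qed
  obtain x where x: "x \<in> pverts G" using verts_nonempty by auto
  have nonneg: "0 \<le> (\<Sum>j\<in>pverts G. hitting_time j i * (deg j / ?m))" if "i \<in> pverts G" for i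
    using that pos by (intro sum_nonneg mult_nonneg_nonneg hitting_time_nonneg divide_nonneg_pos) (auto simp: deg_def)
  show K: "?K \<ge> 0" using nonneg[OF x] sum_hit[OF x] by simp
  have "(\<Sum>j\<in>pverts G. mean_first_passage_time G i j * ennreal (pmf (stationary_distribution G) j)) - 1
      = ennreal ?K" if i: "i \<in> pverts G" for i
  proof -
    have "(\<Sum>j\<in>pverts G. mean_first_passage_time G i j * ennreal (pmf (stationary_distribution G) j)) =
        (\<Sum>j\<in>pverts G. ennreal (hitting_time j i * (deg j / ?m) + (if i = j then 1 else 0)))"
    proof (intro sum.cong refl)
      fix j assume j: "j \<in> pverts G"
      have "mean_first_passage_time G i j * ennreal (pmf (stationary_distribution G) j) =
          ennreal ((hitting_time j i + (if i = j then ?m / deg j else 0)) * (deg j / ?m))"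
        unfolding mean_first_passage_time_tree[OF n i j] pmf_stationary_distribution[OF n j]
        using pos hitting_time_nonneg[OF i j]
        by (subst ennreal_mult) (auto simp: deg_def intro!: add_nonneg_nonneg divide_nonneg_pos)
      also have "(hitting_time j i + (if i = j then ?m / deg j else 0)) * (deg j / ?m) =
          hitting_time j i * (deg j / ?m) + (if i = j then 1 else 0)"
        using pos deg_pos[OF n j] by (simp add: field_simps)
      finally show "mean_first_passage_time G i j * ennreal (pmf (stationary_distribution G) j) =
        ennreal (hitting_time j i * (deg j / ?m) + (if i = j then 1 else 0))" .
    qed
    also have "\<dots> = ennreal (\<Sum>j\<in>pverts G. hitting_time j i * (deg j / ?m) + (if i = j then 1 else 0))"
      using pos hitting_time_nonneg[OF i]
      by (intro sum_ennreal add_nonneg_nonneg mult_nonneg_nonneg divide_nonneg_pos) (auto simp: deg_def)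
    also have "(\<Sum>j\<in>pverts G. hitting_time j i * (deg j / ?m) + (if i = j then 1 else 0)) = ?K + 1"
      using i finite_verts by (simp only: sum.distrib sum_hit[OF i]) simp
    also have "ennreal (?K + 1) - 1 = ennreal ?K"
      using ennreal_minus[of 1 "?K + 1"] K by simp
    finally show ?thesis .
  qed
  then have "(THE \<kappa>. \<forall>i\<in>pverts G. \<kappa> =
        (\<Sum>j\<in>pverts G. mean_first_passage_time G i j *
           ennreal (pmf (stationary_distribution G) j)) - 1) = ennreal ?K"
    using x by (intro the_equality) auto
  then show "kemeny G = ennreal ?K"
    using n by (simp add: kemeny_def)
qed

end

section \<open>Trees around a longest geodesic\<close>

definition gap :: "nat \<Rightarrow> nat \<Rightarrow> nat" where
  "gap i j = (i - j) + (j - i)"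

context tree_distance begin

text \<open>
  A walk that never turns back and starts by moving away from \<open>x\<close> moves away from \<open>x\<close> forever:
  coming closer again at \<open>w (i + 1)\<close> would make \<open>w (i + 2)\<close> its second neighbour closer to \<open>x\<close>.
\<close>

lemma dist_grows:
  assumes x: "x \<in> pverts G"
    and path: "\<And>i. i < k \<Longrightarrow> (w i, w (Suc i)) \<in> parcs G"
    and nonback: "\<And>i. Suc i < k \<Longrightarrow> w i \<noteq> w (Suc (Suc i))"
    and start: "k > 0 \<Longrightarrow> d x (w 1) = Suc (d x (w 0))"
    and "i \<le> k"
  shows "d x (w i) = d x (w 0) + i"
proof -
  have step: "d x (w (Suc i)) = Suc (d x (w i))" if "i < k" for i
    using that
  proof (induction i)
    case 0
    then show ?case using start by simp
  next
    case (Suc i)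
    then have up: "d x (w (Suc i)) = Suc (d x (w i))" by simp
    have arcs: "(w i, w (Suc i)) \<in> parcs G" "(w (Suc i), w (Suc (Suc i))) \<in> parcs G"
      using Suc.prems path by auto
    have "x \<noteq> w (Suc i)" using up x by auto
    then have "d x (w (Suc i)) \<noteq> Suc (d x (w (Suc (Suc i))))"
      using parent[OF x, of "w (Suc i)"] up arcs arc_sym arcs_in_verts nonback[OF Suc.prems] by blast
    then show ?case using dist_step[OF x arcs(2)] by blast
  qed
  show ?thesis using \<open>i \<le> k\<close> by (induction i) (auto simp: step)
qed

lemma exists_geodesic:
  assumes "a \<in> pverts G" "b \<in> pverts G"
  shows "\<exists>v. v 0 = a \<and> v (d a b) = b \<and> (\<forall>i\<le>d a b. d a (v i) = i) \<and>
    (\<forall>i<d a b. (v i, v (Suc i)) \<in> parcs G)"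
  using assms(2)
proof (induction "d a b" arbitrary: b)
  case 0
  then have "a = b" using assms by (simp add: dist_eq_0_iff)
  then show ?case using assms by (intro exI[of _ "\<lambda>_. a"]) auto
next
  case (Suc n)
  then have "a \<noteq> b" using assms by auto
  then obtain u where u: "(u, b) \<in> parcs G" "d a b = Suc (d a u)" using parent assms Suc by blast
  then have n: "d a u = n" "u \<in> pverts G" using Suc arcs_in_verts by auto
  then obtain v where v: "v 0 = a" "v n = u" "\<forall>i\<le>n. d a (v i) = i"
      "\<forall>i<n. (v i, v (Suc i)) \<in> parcs G"
    using Suc(1)[of u] by auto
  show ?case
    using v u n
    by (intro exI[of _ "fun_upd v (Suc n) b"]) (auto simp: less_Suc_eq le_Suc_eq)
qed

end

text \<open>
  Since a tree contains only one path between two vertices, it suffices that the path has no repeated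
  vertex: it is then a geodesic (\<open>dist_path\<close>), and \<open>\<delta>\<close> is the diameter.
\<close>

locale diametral_path = tree_distance G d for G :: "'a pair_pre_digraph" and d +
  fixes \<delta> :: nat and v :: "nat \<Rightarrow> 'a"
  assumes dist_le: "x \<in> pverts G \<Longrightarrow> y \<in> pverts G \<Longrightarrow> d x y \<le> \<delta>"
    and path_start: "v 0 \<in> pverts G"
    and path_arc: "i < \<delta> \<Longrightarrow> (v i, v (Suc i)) \<in> parcs G"
    and path_inj: "inj_on v {..\<delta>}"
begin

lemma path_in_verts: "i \<le> \<delta> \<Longrightarrow> v i \<in> pverts G"
  using path_start path_arc arcs_in_verts by (cases i) (auto simp: Suc_le_eq)

definition off_path :: "'a set" where
  "off_path = pverts G - v ` {..\<delta>}"

lemma off_path_in_verts: "x \<in> off_path \<Longrightarrow> x \<in> pverts G"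
  by (simp add: off_path_def)

lemma finite_off_path: "finite off_path"
  using finite_verts by (simp add: off_path_def)

text \<open>
  From its point nearest to \<open>x\<close> the path leads away from \<open>x\<close> in both directions.
\<close>

lemma dist_along_path:
  assumes x: "x \<in> pverts G" and p: "p \<le> \<delta>" and min: "\<And>j. j \<le> \<delta> \<Longrightarrow> d x (v p) \<le> d x (v j)"
    and "j \<le> \<delta>"
  shows "d x (v j) = d x (v p) + gap p j"
proof (cases "p \<le> j")
  case True
  have "d x (v (p + (j - p))) = d x (v (p + 0)) + (j - p)"
  proof (rule dist_grows[OF x, of "j - p" "\<lambda>i. v (p + i)"])
    show "(v (p + i), v (p + Suc i)) \<in> parcs G" if "i < j - p" for i
      using that path_arc[of "p + i"] \<open>j \<le> \<delta>\<close> by simp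
    show "v (p + i) \<noteq> v (p + Suc (Suc i))" if "Suc i < j - p" for i
    proof
      assume "v (p + i) = v (p + Suc (Suc i))"
      then have "p + i = p + Suc (Suc i)" using path_inj that \<open>j \<le> \<delta>\<close> by (elim inj_onD) auto
      then show False by simp
    qed
    show "d x (v (p + 1)) = Suc (d x (v (p + 0)))" if "0 < j - p"
      using that \<open>j \<le> \<delta>\<close> dist_step[OF x path_arc[of p]] min[of "Suc p"] by auto
  qed simp
  then show ?thesis using True by (simp add: gap_def)
next
  case False
  have "d x (v (p - (p - j))) = d x (v (p - 0)) + (p - j)"
  proof (rule dist_grows[OF x, of "p - j" "\<lambda>i. v (p - i)"])
    show "(v (p - i), v (p - Suc i)) \<in> parcs G" if "i < p - j" for i
      using that arc_sym[OF path_arc[of "p - Suc i"]] p by (simp add: Suc_diff_Suc)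
    show "v (p - i) \<noteq> v (p - Suc (Suc i))" if "Suc i < p - j" for i
    proof
      assume "v (p - i) = v (p - Suc (Suc i))"
      then have "p - i = p - Suc (Suc i)" using path_inj p by (elim inj_onD) auto
      then show False using that by simp
    qed
    show "d x (v (p - 1)) = Suc (d x (v (p - 0)))" if "0 < p - j"
      using that p dist_step[OF x path_arc[of "p - 1"]] min[of "p - 1"] by fastforce
  qed simp
  then show ?thesis using False by (simp add: gap_def)
qed

lemma dist_path:
  assumes "i \<le> \<delta>" "j \<le> \<delta>"
  shows "d (v i) (v j) = gap i j"
  using dist_along_path[OF path_in_verts[OF assms(1)] assms(1) _ assms(2)] assms path_in_verts by simp

definition foot :: "'a \<Rightarrow> nat" where
  "foot x = arg_min_on (\<lambda>j. d x (v j)) {..\<delta>}"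

definition height :: "'a \<Rightarrow> nat" where
  "height x = d x (v (foot x))"

lemma foot_le: "foot x \<le> \<delta>"
  using arg_min_if_finite(1)[of "{..\<delta>}" "\<lambda>j. d x (v j)"] by (auto simp: foot_def)

lemma dist_foot:
  assumes "x \<in> pverts G" "j \<le> \<delta>"
  shows "d x (v j) = height x + gap (foot x) j"
  unfolding height_def
proof (rule dist_along_path[OF assms(1) foot_le _ assms(2)])
  show "d x (v (foot x)) \<le> d x (v j)" if "j \<le> \<delta>" for j
    using arg_min_least[of "{..\<delta>}" j "\<lambda>j. d x (v j)"] that by (auto simp: foot_def)
qed

lemma height_pos:
  assumes "x \<in> off_path"
  shows "height x \<ge> 1"
proof -
  have "x \<noteq> v (foot x)" using assms foot_le[of x] by (auto simp: off_path_def)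
  then have "height x \<noteq> 0"
    using off_path_in_verts[OF assms] path_in_verts[OF foot_le] by (simp add: height_def dist_eq_0_iff)
  then show ?thesis by simp
qed

end

lemma (in tree_distance) exists_diametral_path:
  assumes "diameter G = ereal (real \<delta>)"
  shows "\<exists>v. diametral_path G d \<delta> v"
proof -
  obtain a b where ab: "a \<in> pverts G" "b \<in> pverts G" "d a b = \<delta>"
    and le: "\<forall>x\<in>pverts G. \<forall>y\<in>pverts G. d x y \<le> \<delta>"
    using assms diameter_eq_iff by blast
  obtain v where v: "v 0 = a" "\<forall>i\<le>\<delta>. d a (v i) = i" "\<forall>i<\<delta>. (v i, v (Suc i)) \<in> parcs G"
    using exists_geodesic[OF ab(1,2)] ab(3) by auto
  have "inj_on v {..\<delta>}" by (rule inj_on_inverseI[of _ "d a"]) (use v in auto)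
  then have "diametral_path G d \<delta> v"
    using v ab le by unfold_locales auto
  then show ?thesis by blast
qed

text \<open>
  The distances of \<open>x\<close> from the two ends of the path add up to \<open>2 * height x + \<delta>\<close>, and both are at
  most \<open>\<delta>\<close>.
\<close>

lemma (in diametral_path) diameter_ge_2_of_off_path:
  assumes "off_path \<noteq> {}"
  shows "\<delta> \<ge> 2"
proof -
  obtain x where x: "x \<in> off_path" using assms by auto
  have "height x + gap (foot x) 0 \<le> \<delta>" "height x + gap (foot x) \<delta> \<le> \<delta>"
    using dist_le[OF off_path_in_verts[OF x] path_in_verts] dist_foot[OF off_path_in_verts[OF x]]
    by (metis le0, metis order_refl)
  then show ?thesis using height_pos[OF x] foot_le[of x] by (simp add: gap_def)
qed

lemma (in diametral_path) Suc_diameter_le_card: "Suc \<delta> \<le> card (pverts G)"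
proof -
  have "card (v ` {..\<delta>}) \<le> card (pverts G)"
    using path_in_verts finite_verts by (intro card_mono) auto
  then show ?thesis using path_inj by (simp add: card_image)
qed

section \<open>The minimal sum of distances\<close>

definition spread :: "nat \<Rightarrow> nat \<Rightarrow> nat" where
  "spread \<delta> p = (\<Sum>j\<le>\<delta>. gap p j)"

text \<open>
  Grouping \<open>j\<close> with \<open>\<delta> - j\<close>, the triangle inequality bounds each group from below, with equality
  if \<open>p\<close> lies between \<open>j\<close> and \<open>\<delta> - j\<close>. All groups are tight only for the two (possibly equal)
  central positions.
\<close>

lemma spread_min:
  assumes "p \<le> \<delta>"
  shows "spread \<delta> (\<delta> div 2) \<le> spread \<delta> p"
    and "spread \<delta> p = spread \<delta> (\<delta> div 2) \<Longrightarrow> p = \<delta> div 2 \<or> p = \<delta> - \<delta> div 2"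
proof -
  define c where "c = \<delta> div 2"
  have \<delta>: "\<delta> = 2 * c \<or> \<delta> = Suc (2 * c)" unfolding c_def by presburger
  have twice: "2 * spread \<delta> p = (\<Sum>j\<le>\<delta>. gap p j + gap p (\<delta> - j))" for p
  proof -
    have "(\<Sum>j\<le>\<delta>. gap p (\<delta> - j)) = spread \<delta> p"
      unfolding spread_def by (rule sum.reindex_bij_witness[of _ "\<lambda>j. \<delta> - j" "\<lambda>j. \<delta> - j"]) auto
    then show ?thesis by (simp add: sum.distrib spread_def)
  qed
  have central: "gap c j + gap c (\<delta> - j) = gap j (\<delta> - j)" if "j \<le> \<delta>" for j
    using that \<delta> by (cases "j \<le> c") (auto simp: gap_def)
  have triangle: "gap j (\<delta> - j) \<le> gap p j + gap p (\<delta> - j)" for j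
    unfolding gap_def by linarith
  have le: "gap c j + gap c (\<delta> - j) \<le> gap p j + gap p (\<delta> - j)" if "j \<le> \<delta>" for j
    using central[OF that] triangle[of j] by simp
  have "2 * spread \<delta> c \<le> 2 * spread \<delta> p"
    unfolding twice by (intro sum_mono le) simp
  then show "spread \<delta> (\<delta> div 2) \<le> spread \<delta> p" by (simp add: c_def)
  show "p = \<delta> div 2 \<or> p = \<delta> - \<delta> div 2" if eq: "spread \<delta> p = spread \<delta> (\<delta> div 2)"
  proof (rule ccontr)
    assume "\<not> ?thesis"
    then have "gap c c + gap c (\<delta> - c) < gap p c + gap p (\<delta> - c)"
      using \<delta> unfolding c_def[symmetric] by (auto simp: gap_def)
    moreover have "c \<le> \<delta>" by (simp add: c_def)
    ultimately have "2 * spread \<delta> c < 2 * spread \<delta> p"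
      unfolding twice by (intro sum_strict_mono_ex1) (use le in auto)
    then show False using eq by (simp add: c_def)
  qed
qed

text \<open>
  The contributions of the pairs on the path, of the pairs with one vertex on it, and of the pairs
  of distinct vertices off it, if \<open>m\<close> leaves hang at the middle of a path of length \<open>\<delta>\<close>.
\<close>

definition min_dist_sum :: "nat \<Rightarrow> nat \<Rightarrow> nat" where
  "min_dist_sum \<delta> m =
     (\<Sum>i\<le>\<delta>. \<Sum>j\<le>\<delta>. gap i j) + 2 * (m * (Suc \<delta> + spread \<delta> (\<delta> div 2))) + 2 * (m * (m - 1))"

text \<open>
  A path with leaves attached to its middle vertex, described by all distances.
\<close>

definition centred_broom :: "'a pair_pre_digraph \<Rightarrow> ('a \<Rightarrow> 'a \<Rightarrow> nat) \<Rightarrow> nat \<Rightarrow> (nat \<Rightarrow> 'a) \<Rightarrow> bool" where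
  "centred_broom G d \<delta> v \<longleftrightarrow>
     v ` {..\<delta>} \<subseteq> pverts G \<and> (\<forall>i\<le>\<delta>. \<forall>j\<le>\<delta>. d (v i) (v j) = gap i j) \<and>
     (\<forall>x\<in>pverts G - v ` {..\<delta>}. (\<forall>j\<le>\<delta>. d x (v j) = Suc (gap (\<delta> div 2) j)) \<and>
       (\<forall>y\<in>pverts G - v ` {..\<delta>}. x \<noteq> y \<longrightarrow> d x y = 2))"

context diametral_path begin

definition high :: "'a set" where
  "high = {x \<in> off_path. height x \<ge> 2}"

text \<open>
  Orient each edge off the path away from \<open>v 0\<close>. Its head determines its tail, and the head has
  height at least 2: a vertex of height 1 has its parent on the path.
\<close>

lemma card_off_path_arcs:
  "card (parcs G \<inter> off_path \<times> off_path) \<le> 2 * card high"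
proof -
  let ?a = "v 0"
  let ?down = "{(x, y) \<in> parcs G \<inter> off_path \<times> off_path. d ?a y = Suc (d ?a x)}"
  let ?up = "{(x, y) \<in> parcs G \<inter> off_path \<times> off_path. d ?a x = Suc (d ?a y)}"
  have fin: "finite (parcs G \<inter> off_path \<times> off_path)"
    using finite_off_path by simp
  have "e = e'" if down: "e \<in> ?down" "e' \<in> ?down" and snd: "snd e = snd e'" for e e'
  proof -
    obtain x x' y where e: "e = (x, y)" "e' = (x', y)" using snd by (cases e; cases e') auto
    have "?a \<noteq> y" "y \<in> pverts G" using down(1) e arcs_in_verts path_start by auto
    then show "e = e'" using parent[OF path_start, of y] down e by auto
  qed
  then have "inj_on snd ?down" by (intro inj_onI)
  moreover have "snd ` ?down \<subseteq> high"
  proof clarify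
    fix x y assume xy: "(x, y) \<in> parcs G" "x \<in> off_path" "y \<in> off_path" "d ?a y = Suc (d ?a x)"
    have y: "y \<in> pverts G" "?a \<noteq> y" using xy path_start arcs_in_verts by auto
    have "height y \<noteq> 1"
    proof
      assume h: "height y = 1"
      let ?p = "foot y"
      have p: "v ?p \<in> pverts G" using path_in_verts[OF foot_le] .
      have "(v ?p, y) \<in> parcs G"
        using h dist_eq_1_iff[OF y(1) p] arc_sym by (simp add: height_def)
      moreover have "d ?a y = Suc (d ?a (v ?p))"
        using dist_foot[OF y(1), of 0] dist_path[of 0 ?p] h foot_le y path_start
        by (simp add: dist_sym[of ?a y] gap_def)
      ultimately have "x = v ?p" using parent[OF path_start y] xy by auto
      then show False using xy(2) foot_le by (auto simp: off_path_def)
    qed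
    then show "snd (x, y) \<in> high" using height_pos[OF xy(3)] xy(3) by (auto simp: high_def)
  qed
  ultimately have down: "card ?down \<le> card high"
    using finite_off_path by (intro card_inj_on_le[of snd]) (auto simp: high_def)
  have "?up = prod.swap ` ?down" using arc_sym by (force simp: image_iff)
  then have up: "card ?up = card ?down" by (simp add: card_image)
  have union: "parcs G \<inter> off_path \<times> off_path = ?down \<union> ?up"
    using dist_step[OF path_start] by auto
  have "card (parcs G \<inter> off_path \<times> off_path) = card (?down \<union> ?up)"
    by (rule arg_cong[OF union])
  also have "\<dots> \<le> card ?down + card ?up" by (rule card_Un_le)
  also have "\<dots> \<le> 2 * card high" using up down by linarith
  finally show ?thesis .
qed

lemma dist_sum_split:
  "dist_sum = (\<Sum>i\<le>\<delta>. \<Sum>j\<le>\<delta>. gap i j) + 2 * (\<Sum>x\<in>off_path. Suc \<delta> * height x + spread \<delta> (foot x))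
     + (\<Sum>x\<in>off_path. \<Sum>y\<in>off_path. d x y)"
proof -
  have P: "v ` {..\<delta>} \<subseteq> pverts G" using path_in_verts by auto
  have split: "(\<Sum>x\<in>pverts G. f x) = (\<Sum>i\<le>\<delta>. f (v i)) + (\<Sum>x\<in>off_path. f x)" for f :: "'a \<Rightarrow> nat"
    unfolding off_path_def
    using sum.subset_diff[OF P finite_verts, of f] path_inj by (simp add: sum.reindex add.commute)
  have off: "(\<Sum>j\<le>\<delta>. d x (v j)) = Suc \<delta> * height x + spread \<delta> (foot x)" if "x \<in> off_path" for x
    using dist_foot[OF off_path_in_verts[OF that]] by (simp add: sum.distrib spread_def)
  have "(\<Sum>i\<le>\<delta>. \<Sum>x\<in>off_path. d (v i) x) = (\<Sum>x\<in>off_path. \<Sum>i\<le>\<delta>. d x (v i))"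
    by (subst sum.swap) (intro sum.cong refl dist_sym off_path_in_verts path_in_verts, auto)
  then show ?thesis
    unfolding dist_sum_def split by (simp add: sum.distrib dist_path off)
qed

lemma card_off_path: "card off_path = card (pverts G) - \<delta> - 1"
proof -
  have "v ` {..\<delta>} \<subseteq> pverts G" using path_in_verts by auto
  then show ?thesis unfolding off_path_def using path_inj by (simp add: card_Diff_subset card_image)
qed

lemma sum_pairs_const:
  "(\<Sum>x\<in>off_path. \<Sum>y\<in>off_path. if x = y then 0 else 2) = 2 * (card off_path * (card off_path - 1))"
proof -
  have "(\<Sum>y\<in>off_path. if x = y then 0 else (2::nat)) = 2 * (card off_path - 1)" if "x \<in> off_path" for x
  proof -
    have "(\<Sum>y\<in>off_path. if x = y then 0 else (2::nat)) = (\<Sum>y\<in>off_path - {x}. 2)"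
      using that finite_off_path by (intro sum.mono_neutral_cong_right) auto
    then show ?thesis using that finite_off_path by simp
  qed
  then show ?thesis by simp
qed

lemma pair_dist_ge:
  assumes "x \<in> off_path" "y \<in> off_path"
  shows "(if x = y then 0 else 2) \<le> d x y + (if (x, y) \<in> parcs G then 1 else 0)"
  using dist_eq_0_iff[of x y] dist_eq_1_iff[of x y] off_path_in_verts assms by fastforce

text \<open>
  A vertex of height at least 2 adds at least \<open>\<delta> + 1\<close> to its distances to the path (counted twice in
  the sum), while the edges off the path, counted in both directions, save at most 2 per such vertex.
  The surplus \<open>2 * \<delta>\<close> per high vertex and the excess spread of the feet are kept for the case of
  equality.
\<close>

lemma dist_sum_lower_bound:
  "min_dist_sum \<delta> (card off_path) + 2 * \<delta> * card high
     + 2 * (\<Sum>x\<in>off_path. spread \<delta> (foot x) - spread \<delta> (\<delta> div 2)) \<le> dist_sum"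
proof -
  have pairs: "2 * (card off_path * (card off_path - 1)) \<le> (\<Sum>x\<in>off_path. \<Sum>y\<in>off_path. d x y) + 2 * card high"
  proof -
    have "2 * (card off_path * (card off_path - 1)) \<le>
        (\<Sum>x\<in>off_path. \<Sum>y\<in>off_path. d x y + (if (x, y) \<in> parcs G then 1 else 0))"
      unfolding sum_pairs_const[symmetric] by (intro sum_mono pair_dist_ge)
    also have "\<dots> = (\<Sum>x\<in>off_path. \<Sum>y\<in>off_path. d x y) + card (parcs G \<inter> off_path \<times> off_path)"
    proof -
      have "(\<Sum>x\<in>off_path. \<Sum>y\<in>off_path. if (x, y) \<in> parcs G then 1 else 0) =
          (\<Sum>e\<in>off_path \<times> off_path. if e \<in> parcs G then 1 else (0::nat))"
        by (simp add: sum.cartesian_product case_prod_beta)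
      also have "\<dots> = card (parcs G \<inter> off_path \<times> off_path)"
        using finite_off_path by (simp add: sum.inter_restrict[symmetric] Int_commute)
      finally show ?thesis by (simp add: sum.distrib)
    qed
    finally show ?thesis using card_off_path_arcs by linarith
  qed
  have "(\<Sum>x\<in>off_path. Suc \<delta> * height x + spread \<delta> (foot x)) \<ge>
      (\<Sum>x\<in>off_path. Suc \<delta> + spread \<delta> (\<delta> div 2) + (if x \<in> high then Suc \<delta> else 0)
        + (spread \<delta> (foot x) - spread \<delta> (\<delta> div 2)))"
  proof (rule sum_mono)
    fix x assume x: "x \<in> off_path"
    have "Suc \<delta> + (if x \<in> high then Suc \<delta> else 0) = Suc \<delta> * (if x \<in> high then 2 else 1)" by simp
    also have "\<dots> \<le> Suc \<delta> * height x"
      using height_pos[OF x] by (intro mult_le_mono2) (auto simp: high_def)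
    finally show "Suc \<delta> + spread \<delta> (\<delta> div 2) + (if x \<in> high then Suc \<delta> else 0)
        + (spread \<delta> (foot x) - spread \<delta> (\<delta> div 2)) \<le> Suc \<delta> * height x + spread \<delta> (foot x)"
      using spread_min(1)[OF foot_le] by simp
  qed
  also have "(\<Sum>x\<in>off_path. Suc \<delta> + spread \<delta> (\<delta> div 2) + (if x \<in> high then Suc \<delta> else 0)
        + (spread \<delta> (foot x) - spread \<delta> (\<delta> div 2))) =
      card off_path * (Suc \<delta> + spread \<delta> (\<delta> div 2)) + Suc \<delta> * card high
      + (\<Sum>x\<in>off_path. spread \<delta> (foot x) - spread \<delta> (\<delta> div 2))"
  proof -
    have "high \<subseteq> off_path" by (auto simp: high_def)
    then have "(\<Sum>x\<in>off_path. if x \<in> high then Suc \<delta> else 0) = Suc \<delta> * card high"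
      using finite_off_path by (simp add: sum.inter_restrict[symmetric] Int_absorb1)
    then show ?thesis by (simp only: sum.distrib sum_constant) (simp add: algebra_simps)
  qed
  finally show ?thesis
    unfolding dist_sum_split min_dist_sum_def using pairs by (simp add: algebra_simps)
qed

lemma centred_broom_imp_dist_sum:
  assumes "centred_broom G d \<delta> v"
  shows "dist_sum = min_dist_sum \<delta> (card off_path)"
proof -
  have shape: "d x (v j) = Suc (gap (\<delta> div 2) j)" if "x \<in> off_path" "j \<le> \<delta>" for x j
    using assms that by (auto simp: centred_broom_def off_path_def)
  have "Suc \<delta> * height x + spread \<delta> (foot x) = Suc \<delta> + spread \<delta> (\<delta> div 2)" if x: "x \<in> off_path" for x
  proof -
    have "(\<Sum>j\<le>\<delta>. height x + gap (foot x) j) = (\<Sum>j\<le>\<delta>. Suc (gap (\<delta> div 2) j))"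
    proof (intro sum.cong refl)
      fix j assume "j \<in> {..\<delta>}"
      then show "height x + gap (foot x) j = Suc (gap (\<delta> div 2) j)"
        using shape[OF x] dist_foot[OF off_path_in_verts[OF x]] by (metis atMost_iff)
    qed
    then show ?thesis by (simp add: sum.distrib spread_def sum_Suc)
  qed
  moreover have "(\<Sum>x\<in>off_path. \<Sum>y\<in>off_path. d x y) = 2 * (card off_path * (card off_path - 1))"
    unfolding sum_pairs_const[symmetric] using assms
    by (intro sum.cong refl) (auto simp: centred_broom_def off_path_def)
  ultimately show ?thesis unfolding dist_sum_split min_dist_sum_def by simp
qed

text \<open>
  If \<open>\<delta>\<close> is odd there are two central positions, interchanged by reversing the path. All feet agree:
  two vertices off the path are at distance 2, so they have a common neighbour; it lies on the path,
  since there are no edges off the path, and is the foot of both.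
\<close>

lemma centred_broom_of_min:
  assumes min: "dist_sum = min_dist_sum \<delta> (card off_path)"
  shows "centred_broom G d \<delta> v \<or> centred_broom G d \<delta> (\<lambda>i. v (\<delta> - i))"
proof -
  have "high = {}"
  proof (rule ccontr)
    assume ne: "high \<noteq> {}"
    then obtain x where x: "x \<in> off_path" "height x \<ge> 2" by (auto simp: high_def)
    have "\<delta> > 0" using dist_le[OF off_path_in_verts[OF x(1)] path_in_verts[OF foot_le[of x]]] x(2)
      by (auto simp: height_def)
    moreover have "finite high" using finite_off_path by (simp add: high_def)
    then have "card high > 0" using ne by (simp add: card_gt_0_iff)
    ultimately have "2 * \<delta> * card high > 0" by simp
    then show False using dist_sum_lower_bound min by linarith
  qed
  have h: "height x = 1" if "x \<in> off_path" for x
    using height_pos[OF that] \<open>high = {}\<close> that by (auto simp: high_def)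
  have foot_eq: "foot x = \<delta> div 2 \<or> foot x = \<delta> - \<delta> div 2" if x: "x \<in> off_path" for x
  proof (rule spread_min(2)[OF foot_le])
    have "(\<Sum>x\<in>off_path. spread \<delta> (foot x) - spread \<delta> (\<delta> div 2)) = 0"
      using dist_sum_lower_bound min by linarith
    then have "spread \<delta> (foot x) \<le> spread \<delta> (\<delta> div 2)" using x finite_off_path by simp
    then show "spread \<delta> (foot x) = spread \<delta> (\<delta> div 2)"
      using spread_min(1)[OF foot_le] by (rule antisym)
  qed
  have "parcs G \<inter> off_path \<times> off_path = {}"
    using card_off_path_arcs \<open>high = {}\<close> finite_off_path by simp
  then have no_arc: "(x, y) \<notin> parcs G" if "x \<in> off_path" "y \<in> off_path" for x y
    using that by auto
  have ge: "(if x = y then 0 else 2) \<le> d x y" if "x \<in> off_path" "y \<in> off_path" for x y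
    using pair_dist_ge[OF that] no_arc[OF that] by simp
  have pair_sums: "(\<Sum>x\<in>off_path. \<Sum>y\<in>off_path. d x y) = (\<Sum>x\<in>off_path. \<Sum>y\<in>off_path. if x = y then 0 else 2)"
  proof -
    have "(\<Sum>x\<in>off_path. Suc \<delta> * height x + spread \<delta> (foot x)) \<ge> card off_path * (Suc \<delta> + spread \<delta> (\<delta> div 2))"
      using sum_mono[of off_path "\<lambda>_. Suc \<delta> + spread \<delta> (\<delta> div 2)" "\<lambda>x. Suc \<delta> * height x + spread \<delta> (foot x)"]
        h spread_min(1)[OF foot_le] by simp
    then have "(\<Sum>x\<in>off_path. \<Sum>y\<in>off_path. d x y) \<le> 2 * (card off_path * (card off_path - 1))"
      using min unfolding dist_sum_split min_dist_sum_def by simp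
    moreover have "(\<Sum>x\<in>off_path. \<Sum>y\<in>off_path. if x = y then 0 else 2) \<le> (\<Sum>x\<in>off_path. \<Sum>y\<in>off_path. d x y)"
      by (intro sum_mono ge)
    ultimately show ?thesis unfolding sum_pairs_const by simp
  qed
  then have pair: "d x y = 2" if "x \<in> off_path" "y \<in> off_path" "x \<noteq> y" for x y
  proof -
    have *: "(\<Sum>y\<in>off_path. if x = y then 0 else 2) = (\<Sum>y\<in>off_path. d x y)"
      by (rule sum_mono_inv[OF pair_sums[symmetric] _ that(1) finite_off_path]) (intro sum_mono ge)
    show ?thesis
      using sum_mono_inv[OF * _ that(2) finite_off_path] ge[OF that(1)] that(3) by simp
  qed
  have same_foot: "foot x = foot y" if xy: "x \<in> off_path" "y \<in> off_path" "x \<noteq> y" for x y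
  proof -
    have V: "x \<in> pverts G" "y \<in> pverts G" using xy off_path_in_verts by auto
    obtain z where z: "(z, y) \<in> parcs G" "d x y = Suc (d x z)" using parent[OF V xy(3)] by blast
    have zV: "z \<in> pverts G" using z arcs_in_verts by auto
    have "z \<notin> off_path" using no_arc z(1) xy(2) by blast
    then obtain j where j: "j \<le> \<delta>" "z = v j" using zV by (auto simp: off_path_def)
    have "d x z = 1" using z pair[OF xy] by simp
    moreover have "d y z = 1" using z(1) arc_sym dist_eq_1_iff[OF V(2) zV] by blast
    ultimately show ?thesis
      using dist_foot[OF V(1) j(1)] dist_foot[OF V(2) j(1)] h xy j(2) by (auto simp: gap_def)
  qed
  have shape: "centred_broom G d \<delta> v" if "\<And>x. x \<in> off_path \<Longrightarrow> foot x = \<delta> div 2"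
    unfolding centred_broom_def off_path_def[symmetric]
    using path_in_verts dist_path dist_foot[OF off_path_in_verts] that h pair by auto
  have rev: "(\<lambda>i. v (\<delta> - i)) ` {..\<delta>} = v ` {..\<delta>}"
  proof
    show "(\<lambda>i. v (\<delta> - i)) ` {..\<delta>} \<subseteq> v ` {..\<delta>}" by auto
    show "v ` {..\<delta>} \<subseteq> (\<lambda>i. v (\<delta> - i)) ` {..\<delta>}"
    proof clarify
      fix i assume "i \<le> \<delta>"
      then have "v i = v (\<delta> - (\<delta> - i))" by simp
      then show "v i \<in> (\<lambda>i. v (\<delta> - i)) ` {..\<delta>}" by (rule image_eqI) simp
    qed
  qed
  have shape': "centred_broom G d \<delta> (\<lambda>i. v (\<delta> - i))" if f: "\<And>x. x \<in> off_path \<Longrightarrow> foot x = \<delta> - \<delta> div 2"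
    unfolding centred_broom_def rev off_path_def[symmetric]
  proof (intro conjI ballI allI impI)
    show "v ` {..\<delta>} \<subseteq> pverts G" using path_in_verts by auto
    show "d (v (\<delta> - i)) (v (\<delta> - j)) = gap i j" if "i \<le> \<delta>" "j \<le> \<delta>" for i j
      using that by (simp add: dist_path gap_def)
    fix x assume x: "x \<in> off_path"
    show "d x (v (\<delta> - j)) = Suc (gap (\<delta> div 2) j)" if "j \<le> \<delta>" for j
      using that f[OF x] h[OF x] dist_foot[OF off_path_in_verts[OF x], of "\<delta> - j"] by (simp add: gap_def)
    show "d x y = 2" if "y \<in> off_path" "x \<noteq> y" for y using pair x that by blast
  qed
  show ?thesis
  proof (cases "\<exists>x\<in>off_path. foot x \<noteq> \<delta> div 2")
    case True
    then obtain x where x: "x \<in> off_path" "foot x \<noteq> \<delta> div 2" by auto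
    then have "foot y = \<delta> - \<delta> div 2" if "y \<in> off_path" for y
      using same_foot[OF x(1) that] foot_eq[OF x(1)] by (cases "x = y") auto
    then show ?thesis using shape' by blast
  qed (use shape in auto)
qed

end

text \<open>
  Any bijection that matches the paths and the leaves preserves all distances, and adjacency means
  distance 1.
\<close>

lemma centred_broom_imp_isomorphic:
  assumes "tree_distance G d" "tree_distance H e"
    and G: "centred_broom G d \<delta> v" and H: "centred_broom H e \<delta> w"
    and card: "card (pverts G) = card (pverts H)"
  shows "isomorphic G H"
proof -
  interpret G: tree_distance G d by fact
  interpret H: tree_distance H e by fact
  let ?P = "v ` {..\<delta>}" and ?Q = "w ` {..\<delta>}"
  let ?A = "pverts G - v ` {..\<delta>}" and ?B = "pverts H - w ` {..\<delta>}"
  have v: "d (v i) (v j) = gap i j" "v i \<in> pverts G" if "i \<le> \<delta>" "j \<le> \<delta>" for i j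
    using G that by (auto simp: centred_broom_def)
  have w: "e (w i) (w j) = gap i j" "w i \<in> pverts H" if "i \<le> \<delta>" "j \<le> \<delta>" for i j
    using H that by (auto simp: centred_broom_def)
  have inj_v: "inj_on v {..\<delta>}"
  proof (rule inj_onI)
    fix i j assume ij: "i \<in> {..\<delta>}" "j \<in> {..\<delta>}" "v i = v j"
    then have "gap i j = 0" using v[of i j] G.dist_self[of "v j"] v(2)[of j] by simp
    then show "i = j" by (simp add: gap_def)
  qed
  have inj_w: "inj_on w {..\<delta>}"
  proof (rule inj_onI)
    fix i j assume ij: "i \<in> {..\<delta>}" "j \<in> {..\<delta>}" "w i = w j"
    then have "gap i j = 0" using w[of i j] H.dist_self[of "w j"] w(2)[of j] by simp
    then show "i = j" by (simp add: gap_def)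
  qed
  have PG: "?P \<subseteq> pverts G" "?Q \<subseteq> pverts H" using v w by auto
  have "card ?A = card ?B"
    using PG card inj_v inj_w by (simp add: card_Diff_subset card_image)
  then obtain g where g: "bij_betw g ?A ?B"
    using finite_same_card_bij G.finite_verts H.finite_verts by (meson finite_Diff)
  define \<phi> where "\<phi> x = (if x \<in> ?P then w (inv_into {..\<delta>} v x) else g x)" for x
  have \<phi>v: "\<phi> (v i) = w i" if "i \<le> \<delta>" for i using that inj_v by (simp add: \<phi>_def)
  have \<phi>A: "\<phi> x = g x" "\<phi> x \<in> ?B" if "x \<in> ?A" for x
    using that bij_betwE[OF g] by (auto simp: \<phi>_def)
  have cases: "(\<exists>i\<le>\<delta>. x = v i) \<or> x \<in> ?A" if "x \<in> pverts G" for x using that by auto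
  have Avj: "d x (v j) = Suc (gap (\<delta> div 2) j)" "d (v j) x = Suc (gap (\<delta> div 2) j)"
    if "x \<in> ?A" "j \<le> \<delta>" for x j
  proof -
    show "d x (v j) = Suc (gap (\<delta> div 2) j)" using G that by (auto simp: centred_broom_def)
    then show "d (v j) x = Suc (gap (\<delta> div 2) j)" using G.dist_sym[of x "v j"] v(2) that by auto
  qed
  have Bwj: "e x (w j) = Suc (gap (\<delta> div 2) j)" "e (w j) x = Suc (gap (\<delta> div 2) j)"
    if "x \<in> ?B" "j \<le> \<delta>" for x j
  proof -
    show "e x (w j) = Suc (gap (\<delta> div 2) j)" using H that by (auto simp: centred_broom_def)
    then show "e (w j) x = Suc (gap (\<delta> div 2) j)" using H.dist_sym[of x "w j"] w(2) that by auto
  qed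
  have A2: "d x y = (if x = y then 0 else 2)" if "x \<in> ?A" "y \<in> ?A" for x y
    using G that by (auto simp: centred_broom_def)
  have B2: "e x y = (if x = y then 0 else 2)" if "x \<in> ?B" "y \<in> ?B" for x y
    using H that by (auto simp: centred_broom_def)
  have iso: "e (\<phi> x) (\<phi> y) = d x y" if xy: "x \<in> pverts G" "y \<in> pverts G" for x y
  proof -
    consider (PP) i j where "i \<le> \<delta>" "j \<le> \<delta>" "x = v i" "y = v j"
      | (PA) i where "i \<le> \<delta>" "x = v i" "y \<in> ?A"
      | (AP) j where "j \<le> \<delta>" "x \<in> ?A" "y = v j"
      | (AA) "x \<in> ?A" "y \<in> ?A"
      using cases[OF xy(1)] cases[OF xy(2)] by blast
    then show ?thesis
    proof cases
      case AA
      then have "\<phi> x = \<phi> y \<longleftrightarrow> x = y"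
        using bij_betw_imp_inj_on[OF g] \<phi>A by (auto dest: inj_onD)
      then show ?thesis using A2[OF AA] B2[OF \<phi>A(2)[OF AA(1)] \<phi>A(2)[OF AA(2)]] by simp
    qed (use v w Avj Bwj \<phi>v \<phi>A(2) in auto)
  qed
  have img: "\<phi> ` pverts G = pverts H"
  proof
    show "\<phi> ` pverts G \<subseteq> pverts H"
    proof clarify
      fix x assume "x \<in> pverts G"
      then show "\<phi> x \<in> pverts H" using cases[of x] \<phi>v \<phi>A(2)[of x] w(2) by auto
    qed
    show "pverts H \<subseteq> \<phi> ` pverts G"
    proof
      fix y assume y: "y \<in> pverts H"
      show "y \<in> \<phi> ` pverts G"
      proof (cases "y \<in> ?Q")
        case True
        then obtain i where "i \<le> \<delta>" "y = w i" by auto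
        then show ?thesis using \<phi>v v(2) by (metis imageI)
      next
        case False
        then obtain x where "x \<in> ?A" "g x = y" using y g by (metis Diff_iff bij_betw_imp_surj_on imageE)
        then show ?thesis using \<phi>A(1) by (metis Diff_iff imageI)
      qed
    qed
  qed
  have inj: "inj_on \<phi> (pverts G)"
  proof (rule inj_onI)
    fix x y assume xy: "x \<in> pverts G" "y \<in> pverts G" "\<phi> x = \<phi> y"
    then have "d x y = 0" using iso[of x y] img H.dist_self[of "\<phi> y"] by auto
    then show "x = y" using G.dist_eq_0_iff xy by blast
  qed
  have arcs: "(\<phi> x, \<phi> y) \<in> parcs H \<longleftrightarrow> (x, y) \<in> parcs G" if "x \<in> pverts G" "y \<in> pverts G" for x y
    using G.dist_eq_1_iff[OF that] H.dist_eq_1_iff[of "\<phi> x" "\<phi> y"] iso[OF that] img that by auto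
  have img_arcs: "map_prod \<phi> \<phi> ` parcs G = parcs H"
  proof
    show "map_prod \<phi> \<phi> ` parcs G \<subseteq> parcs H"
      using arcs G.arcs_in_verts by auto
    show "parcs H \<subseteq> map_prod \<phi> \<phi> ` parcs G"
    proof clarify
      fix a b assume ab: "(a, b) \<in> parcs H"
      then obtain x y where "x \<in> pverts G" "y \<in> pverts G" "a = \<phi> x" "b = \<phi> y"
        using H.arcs_in_verts[OF ab] img by (metis imageE)
      then show "(a, b) \<in> map_prod \<phi> \<phi> ` parcs G" using ab arcs by force
    qed
  qed
  interpret pG: pair_graph G by (rule G.pair_graph)
  define f where "f = \<lparr>iso_verts = \<phi>, iso_arcs = map_prod \<phi> \<phi>, iso_head = snd, iso_tail = fst\<rparr>"
  have "inj_on (map_prod \<phi> \<phi>) (parcs G)"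
    using inj G.arcs_in_verts by (fastforce simp: inj_on_def)
  then have "pre_digraph.digraph_isomorphism (with_proj G) f"
    using inj pG.wf_digraph_axioms by (auto simp: pre_digraph.digraph_isomorphism_def f_def)
  moreover have "with_proj H = app_iso f (with_proj G)"
    by (simp add: app_iso_def f_def with_proj_def img img_arcs)
  ultimately show ?thesis unfolding isomorphic_def digraph_iso_def by blast
qed

section \<open>Distances in caterpillars\<close>

fun caterpillar_adj :: "nat \<Rightarrow> (nat \<Rightarrow> nat) \<Rightarrow> caterpillar_vertex \<Rightarrow> caterpillar_vertex \<Rightarrow> bool" where
  "caterpillar_adj k p (Spine i) (Spine j) \<longleftrightarrow> 1 \<le> i \<and> i \<le> k \<and> 1 \<le> j \<and> j \<le> k \<and> (j = Suc i \<or> i = Suc j)"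
| "caterpillar_adj k p (Spine i) (Pendent a b) \<longleftrightarrow> i = a \<and> 1 \<le> a \<and> a \<le> k \<and> 1 \<le> b \<and> b \<le> p a"
| "caterpillar_adj k p (Pendent a b) (Spine i) \<longleftrightarrow> i = a \<and> 1 \<le> a \<and> a \<le> k \<and> 1 \<le> b \<and> b \<le> p a"
| "caterpillar_adj k p (Pendent a b) (Pendent a' b') \<longleftrightarrow> False"

fun caterpillar_dist :: "caterpillar_vertex \<Rightarrow> caterpillar_vertex \<Rightarrow> nat" where
  "caterpillar_dist (Spine i) (Spine j) = gap i j"
| "caterpillar_dist (Spine i) (Pendent a b) = Suc (gap a i)"
| "caterpillar_dist (Pendent a b) (Spine i) = Suc (gap a i)"
| "caterpillar_dist (Pendent a b) (Pendent a' b') = (if a = a' \<and> b = b' then 0 else 2 + gap a a')"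

lemma caterpillar_arc_iff: "(u, v) \<in> parcs (caterpillar k p) \<longleftrightarrow> caterpillar_adj k p u v"
  by (cases u; cases v) (auto simp: caterpillar_def Let_def)

lemma caterpillar_verts:
  "pverts (caterpillar k p) = Spine ` {1..k} \<union> (\<lambda>(i, j). Pendent i j) ` (SIGMA i:{1..k}. {1..p i})"
  by (auto simp: caterpillar_def Let_def image_iff)

lemma card_caterpillar: "card (pverts (caterpillar k p)) = k + (\<Sum>i=1..k. p i)"
proof -
  have "card (pverts (caterpillar k p)) =
      card (Spine ` {1..k}) + card ((\<lambda>(i, j). Pendent i j) ` (SIGMA i:{1..k}. {1..p i}))"
    unfolding caterpillar_verts by (intro card_Un_disjoint) auto
  also have "card (Spine ` {1..k}) = k" by (simp add: card_image inj_on_def)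
  also have "card ((\<lambda>(i, j). Pendent i j) ` (SIGMA i:{1..k}. {1..p i})) = (\<Sum>i=1..k. p i)"
    by (subst card_image) (auto simp: inj_on_def)
  finally show ?thesis .
qed

fun caterpillar_base :: "caterpillar_vertex \<Rightarrow> nat" where
  "caterpillar_base (Spine i) = i"
| "caterpillar_base (Pendent a b) = a"

text \<open>
  The neighbour of the second vertex on the path to the first one. When both have the same spine
  vertex and the second one lies on the spine, the first one is itself that neighbour.
\<close>

fun caterpillar_parent :: "caterpillar_vertex \<Rightarrow> caterpillar_vertex \<Rightarrow> caterpillar_vertex" where
  "caterpillar_parent x (Pendent a b) = Spine a"
| "caterpillar_parent x (Spine i) =
     (if caterpillar_base x < i then Spine (i - 1) else if i < caterpillar_base x then Spine (Suc i) else x)"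

lemma tree_distance_caterpillar:
  assumes "k \<ge> 1"
  shows "tree_distance (caterpillar k p) caterpillar_dist"
proof
  have spine: "Spine i \<in> pverts (caterpillar k p) \<longleftrightarrow> 1 \<le> i \<and> i \<le> k" for i
    by (auto simp: caterpillar_verts)
  have pendent: "Pendent a b \<in> pverts (caterpillar k p) \<longleftrightarrow> 1 \<le> a \<and> a \<le> k \<and> 1 \<le> b \<and> b \<le> p a" for a b
    by (auto simp: caterpillar_verts image_iff)
  note [simp] = caterpillar_arc_iff spine pendent
  show "finite (pverts (caterpillar k p))" by (simp add: caterpillar_verts)
  have "Spine 1 \<in> pverts (caterpillar k p)" using assms spine by blast
  then show "pverts (caterpillar k p) \<noteq> {}" by blast
  show "u \<in> pverts (caterpillar k p) \<and> v \<in> pverts (caterpillar k p)"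
    if "(u, v) \<in> parcs (caterpillar k p)" for u v
    using that by (cases u; cases v) auto
  show "(v, u) \<in> parcs (caterpillar k p)" if "(u, v) \<in> parcs (caterpillar k p)" for u v
    using that by (cases u; cases v) auto
  show "caterpillar_dist u v = 0 \<longleftrightarrow> u = v" for u v
    by (cases u; cases v) (auto simp: gap_def)
  show "caterpillar_dist u v = caterpillar_dist v u" for u v
    by (cases u; cases v) (auto simp: gap_def)
  show "caterpillar_dist x u = Suc (caterpillar_dist x v) \<or> caterpillar_dist x v = Suc (caterpillar_dist x u)"
    if "x \<in> pverts (caterpillar k p)" "(u, v) \<in> parcs (caterpillar k p)" for x u v
    using that by (cases x; cases u; cases v) (auto simp: gap_def)
  show "\<exists>!u. (u, v) \<in> parcs (caterpillar k p) \<and> caterpillar_dist x v = Suc (caterpillar_dist x u)"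
    if xv: "x \<in> pverts (caterpillar k p)" "v \<in> pverts (caterpillar k p)" "x \<noteq> v" for x v
  proof (rule ex1I[of _ "caterpillar_parent x v"])
    show "(caterpillar_parent x v, v) \<in> parcs (caterpillar k p) \<and> caterpillar_dist x v = Suc (caterpillar_dist x (caterpillar_parent x v))"
      using xv by (cases x; cases v) (auto simp: gap_def)
    show "u = caterpillar_parent x v" if "(u, v) \<in> parcs (caterpillar k p) \<and> caterpillar_dist x v = Suc (caterpillar_dist x u)" for u
      using xv that by (cases x; cases v; cases u) (auto simp: gap_def split: if_splits)
  qed
qed

text \<open>
  The extremal caterpillar. With a pendent vertex its diameter is \<open>\<delta>\<close> only if \<open>\<delta> \<ge> 2\<close>: attaching a
  leaf to a path with at most two vertices makes the path longer.
\<close>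

context
  fixes \<delta> m :: nat and C :: "caterpillar_vertex pair_pre_digraph"
  assumes C: "C = caterpillar (Suc \<delta>) (\<lambda>i. m * unit_vector (Suc (\<delta> div 2)) i)"
    and large: "m > 0 \<Longrightarrow> \<delta> \<ge> 2"
begin

interpretation C: tree_distance C caterpillar_dist
  unfolding C by (rule tree_distance_caterpillar) simp

lemma in_central_caterpillar_iff:
  "x \<in> pverts C \<longleftrightarrow> (\<exists>i\<le>\<delta>. x = Spine (Suc i)) \<or> (\<exists>j\<in>{1..m}. x = Pendent (Suc (\<delta> div 2)) j)"
proof (cases x)
  case (Spine i)
  then show ?thesis by (cases i) (auto simp: C caterpillar_verts)
next
  case (Pendent a b)
  then show ?thesis by (auto simp: C caterpillar_verts unit_vector_def image_iff split: if_splits)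
qed

lemma card_central_caterpillar: "card (pverts C) = Suc \<delta> + m"
proof -
  have "(\<Sum>i=1..Suc \<delta>. m * unit_vector (Suc (\<delta> div 2)) i) = m"
    by (simp add: unit_vector_def sum_distrib_left[symmetric]) presburger
  then show ?thesis unfolding C card_caterpillar by simp
qed

lemma central_caterpillar_dist_le:
  assumes "x \<in> pverts C" "y \<in> pverts C"
  shows "caterpillar_dist x y \<le> \<delta>"
  using assms large unfolding in_central_caterpillar_iff by (auto simp: gap_def)

lemma diameter_central_caterpillar: "diameter C = ereal (real \<delta>)"
  unfolding C.diameter_eq_iff
proof (intro conjI ballI central_caterpillar_dist_le)
  show "\<exists>x\<in>pverts C. \<exists>y\<in>pverts C. caterpillar_dist x y = \<delta>"
    by (intro bexI[of _ "Spine 1"] bexI[of _ "Spine (Suc \<delta>)"])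
      (auto simp: in_central_caterpillar_iff gap_def)
qed

lemma diametral_path_central_caterpillar: "diametral_path C caterpillar_dist \<delta> (\<lambda>i. Spine (Suc i))"
proof
  show "caterpillar_dist x y \<le> \<delta>" if "x \<in> pverts C" "y \<in> pverts C" for x y
    using that by (rule central_caterpillar_dist_le)
  show "Spine (Suc 0) \<in> pverts C" by (auto simp: in_central_caterpillar_iff)
  show "(Spine (Suc i), Spine (Suc (Suc i))) \<in> parcs C" if "i < \<delta>" for i
    using that by (simp add: C caterpillar_arc_iff)
  show "inj_on (\<lambda>i. Spine (Suc i)) {..\<delta>}" by (simp add: inj_on_def)
qed

lemma centred_broom_central_caterpillar: "centred_broom C caterpillar_dist \<delta> (\<lambda>i. Spine (Suc i))"
  unfolding centred_broom_def by (auto simp: in_central_caterpillar_iff gap_def split: if_splits)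

end

section \<open>The minimizers of Kemeny's constant\<close>

theorem theorem4p3:
  fixes n \<delta> t :: nat and C :: "caterpillar_vertex pair_pre_digraph"
  assumes "(trees n \<delta> :: 'a pair_pre_digraph set) \<noteq> {}"
    and "t = nat \<lceil>(real \<delta> + 1) / 2\<rceil>"
    and "C = caterpillar (\<delta> + 1) (\<lambda>i. (n - \<delta> - 1) * unit_vector t i)"
  shows "C \<in> trees n \<delta> \<and>
    (\<forall>T \<in> (trees n \<delta> :: 'a pair_pre_digraph set).
       kemeny C \<le> kemeny T \<and> (kemeny T = kemeny C \<longrightarrow> isomorphic T C))"
proof -
  define m where "m = n - \<delta> - 1"
  have tree: "tree_distance T (walk_dist T)" "\<exists>v. diametral_path T (walk_dist T) \<delta> v" "card (pverts T) = n"
    if "T \<in> trees n \<delta>" for T :: "'a pair_pre_digraph"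
  proof -
    show T: "tree_distance T (walk_dist T)"
      using that by (intro undirected_tree_imp_tree_distance) (simp add: trees_def)
    show "\<exists>v. diametral_path T (walk_dist T) \<delta> v"
      using that tree_distance.exists_diametral_path[OF T] by (simp add: trees_def)
    show "card (pverts T) = n" using that by (simp add: trees_def)
  qed
  have n: "n = Suc \<delta> + m" and large: "m > 0 \<Longrightarrow> \<delta> \<ge> 2"
  proof -
    obtain T :: "'a pair_pre_digraph" and v where T: "T \<in> trees n \<delta>" and "diametral_path T (walk_dist T) \<delta> v"
      using assms(1) tree(2) by blast
    then interpret T: diametral_path T "walk_dist T" \<delta> v by simp
    show "n = Suc \<delta> + m" using T.Suc_diameter_le_card tree(3)[OF T] by (simp add: m_def)
    show "\<delta> \<ge> 2" if "m > 0"
      using that T.diameter_ge_2_of_off_path T.card_off_path tree(3)[OF T] by (force simp: m_def)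
  qed
  have t: "t = Suc (\<delta> div 2)"
  proof -
    have "\<lceil>(real \<delta> + 1) / 2\<rceil> = int (Suc (\<delta> div 2))"
    proof (rule ceiling_unique)
      have "\<delta> = 2 * (\<delta> div 2) \<or> \<delta> = 2 * (\<delta> div 2) + 1" by presburger
      then have "real \<delta> = 2 * real (\<delta> div 2) \<or> real \<delta> = 2 * real (\<delta> div 2) + 1"
        by (metis of_nat_1 of_nat_add of_nat_mult of_nat_numeral)
      then show "real_of_int (int (Suc (\<delta> div 2))) - 1 < (real \<delta> + 1) / 2"
        "(real \<delta> + 1) / 2 \<le> real_of_int (int (Suc (\<delta> div 2)))" by auto
    qed
    then show ?thesis using assms(2) by simp
  qed
  have C: "C = caterpillar (Suc \<delta>) (\<lambda>i. m * unit_vector (Suc (\<delta> div 2)) i)"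
    using assms(3) by (simp add: t m_def)
  interpret C: diametral_path C caterpillar_dist \<delta> "\<lambda>i. Spine (Suc i)"
    by (rule diametral_path_central_caterpillar[OF C large])
  have cardC: "card (pverts C) = n" using card_central_caterpillar[OF C large] n by simp
  have "C \<in> trees n \<delta>"
    using C.undirected_tree cardC diameter_central_caterpillar[OF C large] by (simp add: trees_def)
  moreover have "kemeny C \<le> kemeny T \<and> (kemeny T = kemeny C \<longrightarrow> isomorphic T C)"
    if T_in: "T \<in> trees n \<delta>" for T :: "'a pair_pre_digraph"
  proof -
    obtain v where "diametral_path T (walk_dist T) \<delta> v" using tree(2)[OF T_in] by blast
    then interpret T: diametral_path T "walk_dist T" \<delta> v .
    note cardT = tree(3)[OF T_in]
    have C_sum: "C.dist_sum = min_dist_sum \<delta> m"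
      using C.centred_broom_imp_dist_sum[OF centred_broom_central_caterpillar[OF C large]]
      by (simp add: C.card_off_path cardC m_def)
    have T_sum: "min_dist_sum \<delta> m \<le> T.dist_sum"
      using T.dist_sum_lower_bound by (simp add: T.card_off_path cardT m_def)
    have iso: "isomorphic T C" if "T.dist_sum = C.dist_sum"
    proof -
      have "centred_broom T (walk_dist T) \<delta> v \<or> centred_broom T (walk_dist T) \<delta> (\<lambda>i. v (\<delta> - i))"
        using that by (intro T.centred_broom_of_min) (simp add: C_sum T.card_off_path cardT m_def)
      then show ?thesis
        using centred_broom_imp_isomorphic[OF T.tree_distance_axioms C.tree_distance_axioms _
            centred_broom_central_caterpillar[OF C large]] cardT cardC by auto
    qed
    show ?thesis
    proof (cases "n \<ge> 2")
      case True
      have nT: "T.num_verts = real n" and nC: "C.num_verts = real n"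
        by (simp_all add: T.num_verts_def C.num_verts_def cardT cardC)
      have kT: "kemeny T = ennreal (real T.dist_sum / (real n - 1) - real n + 1 / 2)"
          "0 \<le> real T.dist_sum / (real n - 1) - real n + 1 / 2"
        using T.kemeny_eq True by (simp_all add: cardT nT)
      have kC: "kemeny C = ennreal (real C.dist_sum / (real n - 1) - real n + 1 / 2)"
          "0 \<le> real C.dist_sum / (real n - 1) - real n + 1 / 2"
        using C.kemeny_eq True by (simp_all add: cardC nC)
      have "kemeny C \<le> kemeny T"
        unfolding kC kT using T_sum C_sum True
        by (intro ennreal_leI) (auto intro: divide_right_mono)
      moreover have "T.dist_sum = C.dist_sum" if "kemeny T = kemeny C"
        using that kT(2) kC(2) True unfolding kT(1) kC(1) by (simp add: ennreal_inj)
      ultimately show ?thesis using iso by blast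
    next
      case False
      then have "n = 1" using n by simp
      moreover have "T.dist_sum = 0"
        using \<open>n = 1\<close> cardT T.dist_self unfolding T.dist_sum_def by (auto simp: card_1_singleton_iff)
      moreover have "C.dist_sum = 0" using C_sum T_sum \<open>T.dist_sum = 0\<close> by simp
      ultimately show ?thesis using iso cardT cardC by (simp add: kemeny_def)
    qed
  qed
  ultimately show ?thesis by blast
qed

end
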